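(* Let $\Omega\subsetneq\mathbb C$ be a domain starlike at infinity such that $0\notin\Omega$ and $it\in\Omega$ for all $t>0$. Then the curve $$\sigma:[1,+\infty)\to\Omega,\qquad \sigma(t):=\frac{\delta^+_{\Omega,0}(t)-\delta^-_{\Omega,0}(t)}{2}+it,$$ can be reparametrized to be a quasi-geodesic in $\Omega$.
   Context: A simply connected domain $\Omega\subsetneq\mathbb C$ is starlike at infinity if $\Omega+it\subseteq\Omega$ for all $t\ge0$. For $t>0$, $$\delta^+_{\Omega,0}(t):=\min\{t,\ \inf\{|z-it|: z\in\mathbb C\setminus\Omega,\ \mathrm{Re}\,z\ge0\}\},\qquad \delta^-_{\Omega,0}(t):=\min\{t,\ \inf\{|z-it|: z\in\mathbb C\setminus\Omega,\ \mathrm{Re}\,z\le0\}\}.$$ The hyperbolic metric of $\Omega$ is $\kappa_\Omega(z;v)=|v|/f'(0)$, where $f:\mathbb D\to\Omega$ is the Riemann map with $f(0)=z$, $f'(0)>0$; $k_\Omega$ is the associated length distance. A curve $\gamma:[a,b)\to\Omega$ ($-\infty<a<b\le+\infty$) is a quasi-geodesic if there are $A\ge1$, $B\ge0$ with $\frac1A(t-s)-B\le k_\Omega(\gamma(s),\gamma(t))\le A(t-s)+B$ for all $a\le s\le t<b$. A curve $\gamma$ can be reparametrized to be a quasi-geodesic if $\gamma\circ\psi$ is a quasi-geodesic for some increasing homeomorphism $\psi$ from an interval $[a',b')$ onto the domain of $\gamma$. *)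

theory Defs
  imports "HOL-Complex_Analysis.Complex_Analysis"
begin

definition starlike_at_infinity :: "complex set \<Rightarrow> bool" where
  "starlike_at_infinity \<Omega> \<longleftrightarrow>
     open \<Omega> \<and> \<Omega> \<noteq> {} \<and> \<Omega> \<noteq> UNIV \<and> connected \<Omega> \<and> simply_connected \<Omega> \<and>
     (\<forall>t::real. t \<ge> 0 \<longrightarrow> (\<lambda>z. z + \<i> * of_real t) ` \<Omega> \<subseteq> \<Omega>)"

(* The infima are over nonempty sets bounded below as soon as 0 \<notin> \<Omega>, so the real-valued
   Inf is then the genuine infimum; the definitions are meant for that case only. *)

definition delta_plus :: "complex set \<Rightarrow> real \<Rightarrow> real" where
  "delta_plus \<Omega> t = min t (INF z\<in>{z. z \<notin> \<Omega> \<and> Re z \<ge> 0}. cmod (z - \<i> * of_real t))"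

definition delta_minus :: "complex set \<Rightarrow> real \<Rightarrow> real" where
  "delta_minus \<Omega> t = min t (INF z\<in>{z. z \<notin> \<Omega> \<and> Re z \<le> 0}. cmod (z - \<i> * of_real t))"

definition riemann_map :: "complex set \<Rightarrow> complex \<Rightarrow> (complex \<Rightarrow> complex) \<Rightarrow> bool" where
  "riemann_map \<Omega> z f \<longleftrightarrow>
     f holomorphic_on ball 0 1 \<and> bij_betw f (ball 0 1) \<Omega> \<and> f 0 = z \<and>
     deriv f 0 \<in> \<real> \<and> Re (deriv f 0) > 0"

(* The map is unique only up to its values outside the unit disc, which do not affect the
   derivative at 0. *)

definition hyperbolic_metric :: "complex set \<Rightarrow> complex \<Rightarrow> complex \<Rightarrow> real" where
  "hyperbolic_metric \<Omega> z v = cmod v / Re (deriv (SOME f. riemann_map \<Omega> z f) 0)"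

(* Infimum of the hyperbolic lengths of piecewise C^1 paths in \<Omega> from z to w. The
   library's valid_path allows the derivative to be unbounded at the finitely many exceptional
   points, so a valid path may have infinite length; has_integral (rather than the total
   function integral, which would return 0) discards such paths. *)

definition hyperbolic_distance :: "complex set \<Rightarrow> complex \<Rightarrow> complex \<Rightarrow> real" where
  "hyperbolic_distance \<Omega> z w =
     Inf {L. \<exists>\<gamma>. valid_path \<gamma> \<and> path_image \<gamma> \<subseteq> \<Omega> \<and> pathstart \<gamma> = z \<and> pathfinish \<gamma> = w \<and>
            ((\<lambda>t. hyperbolic_metric \<Omega> (\<gamma> t) (vector_derivative \<gamma> (at t within {0..1})))
               has_integral L) {0..1}}"

(* The real interval [a, b), where b may be \<infinity>. *)

definition ico :: "real \<Rightarrow> ereal \<Rightarrow> real set" where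
  "ico a b = {t. a \<le> t \<and> ereal t < b}"

definition quasi_geodesic :: "complex set \<Rightarrow> real \<Rightarrow> ereal \<Rightarrow> (real \<Rightarrow> complex) \<Rightarrow> bool" where
  "quasi_geodesic \<Omega> a b \<gamma> \<longleftrightarrow>
     ereal a < b \<and> continuous_on (ico a b) \<gamma> \<and> \<gamma> ` ico a b \<subseteq> \<Omega> \<and>
     (\<exists>A B. A \<ge> 1 \<and> B \<ge> 0 \<and>
        (\<forall>s\<in>ico a b. \<forall>t\<in>ico a b. s \<le> t \<longrightarrow>
           1 / A * (t - s) - B \<le> hyperbolic_distance \<Omega> (\<gamma> s) (\<gamma> t) \<and>
           hyperbolic_distance \<Omega> (\<gamma> s) (\<gamma> t) \<le> A * (t - s) + B))"

definition reparametrizable_quasi_geodesic ::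
  "complex set \<Rightarrow> real \<Rightarrow> ereal \<Rightarrow> (real \<Rightarrow> complex) \<Rightarrow> bool" where
  "reparametrizable_quasi_geodesic \<Omega> a b \<gamma> \<longleftrightarrow>
     (\<exists>a' b' \<psi> \<phi>. ereal a' < b' \<and> homeomorphism (ico a' b') (ico a b) \<psi> \<phi> \<and>
        strict_mono_on (ico a' b') \<psi> \<and> quasi_geodesic \<Omega> a' b' (\<gamma> \<circ> \<psi>))"

end

theory Submission
  imports Defs
begin

text \<open>Let \<open>w\<close> (\<open>width\<close> below) be the sum of \<open>\<delta>\<^sup>+\<close> and \<open>\<delta>\<^sup>-\<close>, a nondecreasing Lipschitz function with
  \<open>w(t) \<le> 2t\<close>. The distance from \<open>\<sigma>(t)\<close> to the boundary is comparable to \<open>w(t)\<close>, and \<open>\<sigma>\<close> becomes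
  a quasi-geodesic when parametrized by \<open>\<Lambda>(t) = \<integral> du/w(u)\<close>, integrated from \<open>1\<close> to \<open>t\<close>.
  For the upper bound, \<open>\<sigma>\<close> is replaced by a nearby \<open>C\<^sup>1\<close> curve and the hyperbolic density
  is at most the inverse distance to the boundary (Schwarz). For the lower bound, a function \<open>T\<close>
  (\<open>param\<close> below) extends \<open>\<sigma>(t) \<mapsto> t\<close>, up to an error \<open>w(t)/2\<close>, to the whole domain in such a way that \<open>\<Lambda> \<circ> T\<close>
  is locally Lipschitz with constant \<open>O(1/dist(z, \<partial>\<Omega>))\<close>; by a weak Koebe theorem it is then
  Lipschitz for the hyperbolic distance.\<close>

section \<open>The hyperbolic density\<close>

lemma Moebius_function_has_field_derivative_centre:
  assumes "norm w < 1"
  shows "(Moebius_function 0 w has_field_derivative 1 / of_real (1 - (norm w)\<^sup>2)) (at w)"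
proof -
  have eq: "1 - cnj w * w = of_real (1 - (norm w)\<^sup>2)"
    by (simp add: complex_norm_square mult.commute del: of_real_power)
  have nz: "(1 - (norm w)\<^sup>2) \<noteq> 0"
    using assms power_less_one_iff[of "norm w" 2] by auto
  have nz': "1 - cnj w * w \<noteq> 0"
    unfolding eq of_real_eq_0_iff by (rule nz)
  have *: "((\<lambda>z. (z - w) / (1 - cnj w * z)) has_field_derivative 1 / (1 - cnj w * w)) (at w)"
    using nz' by (auto intro!: derivative_eq_intros simp: divide_simps)
  show ?thesis
    using * unfolding eq by (simp add: Moebius_function_simple[abs_def])
qed

text \<open>The Schwarz lemma bounds the derivatives at 0 of \<open>f\<close> and of its inverse by
  1 in norm, and their product is 1.\<close>

lemma norm_deriv_disc_automorphism:
  assumes hol: "f holomorphic_on ball 0 1" and bij: "bij_betw f (ball 0 1) (ball 0 1)" and "f 0 = 0"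
  shows "norm (deriv f 0) = 1"
proof -
  obtain g where g: "g holomorphic_on (f ` ball 0 1)"
      "\<And>z. z \<in> ball 0 1 \<Longrightarrow> deriv f z * deriv g (f z) = 1" "\<And>z. z \<in> ball 0 1 \<Longrightarrow> g (f z) = z"
    using holomorphic_has_inverse[OF hol open_ball] bij by (auto simp: bij_betw_def)
  have img: "f ` ball 0 1 = ball 0 1" using bij by (auto simp: bij_betw_def)
  have 1: "norm (deriv f 0) \<le> 1"
    using Schwarz_Lemma'[OF hol \<open>f 0 = 0\<close>] img by (metis imageI mem_ball_0)
  have "norm (g z) < 1" if "norm z < 1" for z
    using that g(3) img by (metis imageE mem_ball_0)
  moreover have "g 0 = 0" using g(3)[of 0] \<open>f 0 = 0\<close> by simp
  ultimately have 2: "norm (deriv g 0) \<le> 1"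
    using Schwarz_Lemma'[of g] g(1) img by auto
  have "norm (deriv f 0) * norm (deriv g 0) = 1"
    using g(2)[of 0] \<open>f 0 = 0\<close> by (metis centre_in_ball norm_mult norm_one zero_less_one)
  then show ?thesis
    using 1 2 by (metis mult_left_le norm_ge_zero order_antisym)
qed

text \<open>Following \<open>f\<close> and \<open>F\<close> by the Moebius map that sends
  \<open>F z\<close> to 0 gives a disc automorphism fixing 0, whose derivative there has norm 1; the
  chain rule evaluates that derivative. A single \<open>F\<close> thus serves for all base
  points.\<close>

lemma riemann_map_deriv_eq:
  assumes f: "riemann_map \<Omega> z f" and "open \<Omega>" and "z \<in> \<Omega>"
    and F: "F holomorphic_on \<Omega>" "bij_betw F \<Omega> (ball 0 1)"
  shows "Re (deriv f 0) * norm (deriv F z) = 1 - (norm (F z))\<^sup>2"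
proof -
  define m where "m = Moebius_function 0 (F z)"
  have Fz: "norm (F z) < 1" using F(2) \<open>z \<in> \<Omega>\<close> by (auto simp: bij_betw_def)
  have fh: "f holomorphic_on ball 0 1" "bij_betw f (ball 0 1) \<Omega>" "f 0 = z"
    using f by (auto simp: riemann_map_def)
  have mb: "bij_betw m (ball 0 1) (ball 0 1)"
    unfolding m_def
    by (rule bij_betw_byWitness[where f' = "Moebius_function 0 (- F z)"])
       (use Fz Moebius_function_compose Moebius_function_norm_lt_1 in auto)
  have mh: "m holomorphic_on ball 0 1"
    unfolding m_def by (rule Moebius_function_holomorphic[OF Fz])
  have hol: "(m \<circ> F \<circ> f) holomorphic_on ball 0 1"
    unfolding o_assoc[symmetric]
  proof (rule holomorphic_on_compose_gen[OF _ mh])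
    show "(F \<circ> f) holomorphic_on ball 0 1"
      using fh by (intro holomorphic_on_compose_gen[OF _ F(1)]) (auto simp: bij_betw_def)
    show "(F \<circ> f) ` ball 0 1 \<subseteq> ball 0 1"
      using fh(2) F(2) unfolding bij_betw_def image_comp[symmetric] by simp
  qed
  have bij: "bij_betw (m \<circ> F \<circ> f) (ball 0 1) (ball 0 1)"
    using mb F(2) fh(2) by (auto intro: bij_betw_trans)
  have "(m \<circ> F \<circ> f) 0 = 0" using fh by (simp add: m_def Moebius_function_eq_zero)
  then have "norm (deriv (m \<circ> F \<circ> f) 0) = 1"
    using norm_deriv_disc_automorphism[OF hol bij] by simp
  moreover have "(m \<circ> F \<circ> f has_field_derivative
      1 / of_real (1 - (norm (F z))\<^sup>2) * deriv F z * deriv f 0) (at 0)"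
  proof (intro DERIV_chain)
    show "(f has_field_derivative deriv f 0) (at 0)"
      using fh(1) by (auto intro: holomorphic_derivI[OF _ open_ball])
    show "(F has_field_derivative deriv F z) (at (f 0))"
      using F(1) assms fh by (auto intro: holomorphic_derivI)
    show "(m has_field_derivative 1 / of_real (1 - (norm (F z))\<^sup>2)) (at (F (f 0)))"
      using Moebius_function_has_field_derivative_centre[OF Fz] fh by (simp add: m_def)
  qed
  ultimately have "norm (1 / of_real (1 - (norm (F z))\<^sup>2) * deriv F z * deriv f 0) = 1"
    using DERIV_imp_deriv by metis
  moreover have "norm (deriv f 0) = Re (deriv f 0)"
    using f by (auto simp: riemann_map_def complex_is_Real_iff cmod_eq_Re)
  moreover have "(norm (F z))\<^sup>2 < 1"
    using Fz power_less_one_iff[of "norm (F z)" 2] by auto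
  then have "norm (complex_of_real (1 - (norm (F z))\<^sup>2)) = 1 - (norm (F z))\<^sup>2"
    unfolding norm_of_real by simp
  ultimately show ?thesis
    using \<open>(norm (F z))\<^sup>2 < 1\<close>
    by (simp only: norm_mult norm_divide norm_one) (simp add: field_simps)
qed

text \<open>This ensures that \<open>SOME\<close> in \<open>hyperbolic_metric\<close> selects a
  genuine Riemann map: precompose the inverse of \<open>F\<close> with a disc automorphism taking 0
  to \<open>F z\<close>, then with a rotation.\<close>

lemma riemann_map_exists:
  assumes "open \<Omega>" "z \<in> \<Omega>" and F: "F holomorphic_on \<Omega>" "bij_betw F \<Omega> (ball 0 1)"
  shows "\<exists>f. riemann_map \<Omega> z f"
proof -
  have injF: "inj_on F \<Omega>" and imF: "F ` \<Omega> = ball 0 1" using F by (auto simp: bij_betw_def)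
  obtain G where G: "G holomorphic_on (ball 0 1)" "\<And>z. z \<in> \<Omega> \<Longrightarrow> G (F z) = z"
    using holomorphic_has_inverse[OF F(1) \<open>open \<Omega>\<close> injF] imF by metis
  have Gb: "bij_betw G (ball 0 1) \<Omega>"
    by (rule bij_betw_byWitness[where f' = F]) (use G imF in \<open>auto simp: image_subset_iff\<close>, (metis G(2) imF imageE mem_ball_0)+)
  define m where "m = Moebius_function 0 (- F z)"
  have Fz: "norm (F z) < 1" using imF \<open>z \<in> \<Omega>\<close> by auto
  have mb: "bij_betw m (ball 0 1) (ball 0 1)"
    unfolding m_def
    by (rule bij_betw_byWitness[where f' = "Moebius_function 0 (F z)"])
       (use Fz Moebius_function_compose Moebius_function_norm_lt_1 in auto)
  have mh: "m holomorphic_on ball 0 1"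
    unfolding m_def by (rule Moebius_function_holomorphic) (use Fz in auto)
  define h where "h = G \<circ> m"
  have hh: "h holomorphic_on ball 0 1"
    unfolding h_def using mb by (intro holomorphic_on_compose_gen[OF mh G(1)]) (auto simp: bij_betw_def)
  have hb: "bij_betw h (ball 0 1) \<Omega>"
    unfolding h_def by (rule bij_betw_trans[OF mb Gb])
  have h0: "h 0 = z" using G(2) \<open>z \<in> \<Omega>\<close> by (simp add: h_def m_def Moebius_function_of_zero)
  have nz: "deriv h 0 \<noteq> 0"
    using holomorphic_injective_imp_regular[OF hh open_ball] hb by (auto simp: bij_betw_def)
  \<comment> \<open>Rotating by this unimodular number turns the derivative at 0 into its
    modulus.\<close>
  define c where "c = cnj (sgn (deriv h 0))"
  have nc: "norm c = 1" using nz by (simp add: c_def norm_sgn)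
  have c1: "deriv h 0 * c = of_real (norm (deriv h 0))"
    using nz unfolding c_def sgn_eq
    by (simp add: complex_norm_square[symmetric] power2_eq_square)
  have cb: "bij_betw ((*) c) (ball 0 1) (ball 0 1)"
  proof (rule bij_betw_byWitness[where f' = "(*) (inverse c)"])
    show "\<forall>a\<in>ball 0 1. inverse c * (c * a) = a" "\<forall>a\<in>ball 0 1. c * (inverse c * a) = a"
      using nz by (auto simp: c_def sgn_zero_iff)
  qed (use nc in \<open>auto simp: norm_mult norm_inverse\<close>)
  define f where "f = h \<circ> (*) c"
  have "f holomorphic_on ball 0 1"
    unfolding f_def using cb
    by (intro holomorphic_on_compose_gen[OF _ hh]) (auto intro!: holomorphic_intros simp: bij_betw_def)
  moreover have "bij_betw f (ball 0 1) \<Omega>"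
    unfolding f_def by (rule bij_betw_trans[OF cb hb])
  moreover have "(f has_field_derivative deriv h 0 * c) (at 0)"
    unfolding f_def
  proof (rule DERIV_chain)
    show "(h has_field_derivative deriv h 0) (at (c * 0))"
      using hh by (auto intro: holomorphic_derivI[OF _ open_ball])
  qed (auto intro!: derivative_eq_intros)
  then have "deriv f 0 = of_real (norm (deriv h 0))"
    unfolding c1 by (rule DERIV_imp_deriv)
  ultimately show ?thesis
    using nz h0 unfolding riemann_map_def by (auto simp: f_def)
qed

locale hyperbolic_domain =
  fixes \<Omega> :: "complex set"
  assumes op: "open \<Omega>" and sc: "simply_connected \<Omega>" and nonempty: "\<Omega> \<noteq> {}" and proper: "\<Omega> \<noteq> UNIV"
begin

definition density :: "complex \<Rightarrow> real" where
  "density z = hyperbolic_metric \<Omega> z 1"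

lemma hyperbolic_metric_eq: "hyperbolic_metric \<Omega> z v = density z * norm v"
  by (simp add: density_def hyperbolic_metric_def)

lemma riemann_map_to_disc:
  obtains F where "F holomorphic_on \<Omega>" "bij_betw F \<Omega> (ball 0 1)"
proof -
  obtain F g where "F holomorphic_on \<Omega>" "\<forall>z \<in> \<Omega>. F z \<in> ball 0 1 \<and> g (F z) = z"
      "\<forall>z \<in> ball 0 1. g z \<in> \<Omega> \<and> F (g z) = z"
    using Riemann_mapping_theorem[of \<Omega>] op sc nonempty proper by auto
  then show ?thesis
    by (intro that[of F] bij_betw_byWitness[where f' = g]) auto
qed

lemma obtain_riemann_map:
  assumes "z \<in> \<Omega>"
  obtains f where "riemann_map \<Omega> z f" "density z = 1 / Re (deriv f 0)"
proof -
  obtain F where "F holomorphic_on \<Omega>" "bij_betw F \<Omega> (ball 0 1)" by (rule riemann_map_to_disc)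
  then have "riemann_map \<Omega> z (SOME f. riemann_map \<Omega> z f)"
    by (intro someI_ex[of "riemann_map \<Omega> z"] riemann_map_exists[OF op assms])
  then show ?thesis
    by (rule that) (simp add: density_def hyperbolic_metric_def)
qed

lemma density_pos:
  assumes "z \<in> \<Omega>"
  shows "density z > 0"
proof -
  obtain f where "riemann_map \<Omega> z f" "density z = 1 / Re (deriv f 0)"
    using assms by (rule obtain_riemann_map)
  then show ?thesis by (simp add: riemann_map_def)
qed

text \<open>The density is the pullback by one fixed \<open>F\<close> of the density 1/(1 - |w|^2)
  of the disc, and this formula is visibly continuous.\<close>

lemma continuous_on_density: "continuous_on \<Omega> density"
proof -
  obtain F where F: "F holomorphic_on \<Omega>" "bij_betw F \<Omega> (ball 0 1)"
    by (rule riemann_map_to_disc)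
  have lt: "(norm (F z))\<^sup>2 < 1" if "z \<in> \<Omega>" for z
    using F(2) that power_less_one_iff[of "norm (F z)" 2] by (auto simp: bij_betw_def)
  have "density z = norm (deriv F z) / (1 - (norm (F z))\<^sup>2)" if z: "z \<in> \<Omega>" for z
  proof -
    obtain f where f: "riemann_map \<Omega> z f" "density z = 1 / Re (deriv f 0)"
      using z by (rule obtain_riemann_map)
    have "Re (deriv f 0) \<noteq> 0" using f(1) by (auto simp: riemann_map_def)
    moreover have "norm (deriv F z) \<noteq> 0"
      using riemann_map_deriv_eq[OF f(1) op z F] lt[OF z] by auto
    ultimately show ?thesis
      unfolding f(2) riemann_map_deriv_eq[OF f(1) op z F, symmetric] by simp
  qed
  moreover have "continuous_on \<Omega> (\<lambda>z. norm (deriv F z) / (1 - (norm (F z))\<^sup>2))"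
  proof (intro continuous_on_divide continuous_on_norm continuous_on_diff continuous_on_power continuous_on_const
      holomorphic_on_imp_continuous_on holomorphic_deriv F(1) op)
  qed (use lt in fastforce)
  ultimately show ?thesis by (simp cong: continuous_on_cong)
qed

text \<open>The Schwarz lemma for the inverse Riemann map, restricted to \<open>ball z r\<close> and
  rescaled to the unit disc.\<close>

lemma density_le:
  assumes "ball z r \<subseteq> \<Omega>" "r > 0"
  shows "density z \<le> 1 / r"
proof -
  have "z \<in> \<Omega>" using assms by auto
  then obtain f where f: "riemann_map \<Omega> z f" "density z = 1 / Re (deriv f 0)"
    by (rule obtain_riemann_map)
  then have fh: "f holomorphic_on ball 0 1" "inj_on f (ball 0 1)" "f ` ball 0 1 = \<Omega>" "f 0 = z"
    by (auto simp: riemann_map_def bij_betw_def)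
  obtain g where g: "g holomorphic_on \<Omega>"
      "\<And>z. z \<in> ball 0 1 \<Longrightarrow> deriv f z * deriv g (f z) = 1" "\<And>z. z \<in> ball 0 1 \<Longrightarrow> g (f z) = z"
    using holomorphic_has_inverse[OF fh(1) open_ball fh(2)] fh(3) by metis
  define k where "k = g \<circ> (\<lambda>w. z + of_real r * w)"
  have sub: "z + of_real r * w \<in> \<Omega>" if "norm w < 1" for w
    using assms that by (auto simp: subset_iff dist_norm norm_mult)
  have "k holomorphic_on ball 0 1"
    unfolding k_def using sub
    by (intro holomorphic_on_compose_gen[OF _ g(1)]) (auto intro!: holomorphic_intros)
  moreover have "k 0 = 0" using g(3)[of 0] fh by (simp add: k_def)
  moreover have "norm (k w) < 1" if "norm w < 1" for w
    using sub[OF that] g(3) fh(3) by (metis k_def comp_apply imageE mem_ball_0)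
  ultimately have "norm (deriv k 0) \<le> 1"
    using Schwarz_Lemma' by blast
  moreover have "(k has_field_derivative deriv g z * of_real r) (at 0)"
    unfolding k_def
  proof (rule DERIV_chain)
    show "(g has_field_derivative deriv g z) (at (z + of_real r * 0))"
      using g(1) op \<open>z \<in> \<Omega>\<close> by (auto intro: holomorphic_derivI)
  qed (auto intro!: derivative_eq_intros)
  ultimately have le: "norm (deriv g z) * r \<le> 1"
    using assms by (simp add: DERIV_imp_deriv norm_mult)
  have "norm (deriv f 0) * norm (deriv g z) = 1"
    using g(2)[of 0] fh(4) by (metis centre_in_ball norm_mult norm_one zero_less_one)
  moreover have "norm (deriv f 0) = Re (deriv f 0)"
    using f(1) by (auto simp: riemann_map_def complex_is_Real_iff cmod_eq_Re)
  ultimately have "density z = norm (deriv g z)"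
    using f(2) by (metis mult.commute nonzero_eq_divide_eq mult_zero_left zero_neq_one)
  then show ?thesis using le assms by (simp add: field_simps)
qed

text \<open>A weak form of the Koebe quarter theorem: a branch \<open>L\<close> of \<open>log (f - p)\<close> is such that
  \<open>exp \<circ> L\<close> is injective, so its image contains no disc of radius larger than \<open>\<pi>\<close>;
  Bloch's theorem then bounds \<open>L'(0)\<close>.\<close>

lemma density_ge:
  assumes "z \<in> \<Omega>" "p \<notin> \<Omega>"
  shows "1 / (48 * pi * norm (z - p)) \<le> density z"
proof -
  obtain f where f: "riemann_map \<Omega> z f" "density z = 1 / Re (deriv f 0)"
    using assms(1) by (rule obtain_riemann_map)
  then have fh: "f holomorphic_on ball 0 1" "inj_on f (ball 0 1)" "f ` ball 0 1 = \<Omega>" "f 0 = z"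
    by (auto simp: riemann_map_def bij_betw_def)
  have "(\<lambda>w. f w - p) holomorphic_on ball 0 1" using fh by (intro holomorphic_intros)
  moreover have "f w - p \<noteq> 0" if "w \<in> ball 0 1" for w
    using fh(3) assms that by force
  ultimately obtain L where L: "L holomorphic_on ball 0 1" "\<And>w. w \<in> ball 0 1 \<Longrightarrow> f w - p = exp (L w)"
    using contractible_imp_holomorphic_log[of "\<lambda>w. f w - p" "ball 0 1"] convex_imp_contractible convex_ball by metis
  have d: "deriv f 0 = (z - p) * deriv L 0"
  proof -
    have Ld: "(L has_field_derivative deriv L 0) (at 0)"
      using L(1) by (auto intro: holomorphic_derivI[OF _ open_ball])
    have "((\<lambda>w. p + exp (L w)) has_field_derivative exp (L 0) * deriv L 0) (at 0)"
      by (auto intro!: derivative_eq_intros Ld)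
    then have "(f has_field_derivative exp (L 0) * deriv L 0) (at 0)"
      by (rule has_field_derivative_transform_within_open[of _ _ _ "ball 0 1"])
         (simp_all add: L(2)[symmetric])
    then show ?thesis using L(2)[of 0] fh(4) by (simp add: DERIV_imp_deriv)
  qed
  have "norm (deriv L 0) \<le> 48 * pi"
  proof (rule ccontr)
    assume "\<not> ?thesis"
    \<comment> \<open>The 12 is the constant of Bloch's theorem, and 48 = 12 * 4. Radius
      \<open>4 * pi\<close> leaves room for both the centre \<open>b\<close> and its translate by 2
      * pi * i, where the exponential takes the same value.\<close>
    then have "4 * pi \<le> 1 * norm (deriv L 0) / 12" by simp
    then obtain b where b: "ball b (4 * pi) \<subseteq> L ` ball 0 1"
      using Bloch[OF L(1), of "4 * pi"] by auto
    have "b \<in> ball b (4 * pi)" "b + 2 * of_real pi * \<i> \<in> ball b (4 * pi)"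
      by (auto simp: dist_norm norm_mult)
    then obtain u v where uv: "u \<in> ball 0 1" "v \<in> ball 0 1" "L u = b" "L v = b + 2 * of_real pi * \<i>"
      using b by (metis imageE subsetD)
    then have "f u - p = f v - p" using L(2) by (simp add: exp_add mult_ac)
    then show False using inj_onD[OF fh(2)] uv by fastforce
  qed
  then have "norm (deriv f 0) \<le> 48 * pi * norm (z - p)"
    unfolding d norm_mult using mult_right_mono[OF _ norm_ge_zero, of _ _ "z - p"] by (metis mult.commute)
  moreover have "norm (deriv f 0) = Re (deriv f 0)" "Re (deriv f 0) > 0"
    using f(1) by (auto simp: riemann_map_def complex_is_Real_iff cmod_eq_Re)
  ultimately show ?thesis
    unfolding f(2) by (intro divide_left_mono) auto
qed

end

section \<open>Two facts from real analysis\<close>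

text \<open>Each tag of a division lies between the ends of its interval, so for a fine division the
  estimates from the tag to the two ends add up to a bound on the increment of \<open>H\<close>;
  summing gives a Riemann sum of \<open>f\<close>. The gauge may vary from point to point, so a
  majorant that is merely integrable can be treated.\<close>

lemma straddle_le_integral:
  fixes H f :: "real \<Rightarrow> real"
  assumes "a \<le> b" and f: "f integrable_on {a..b}"
    and H: "\<And>x e. x \<in> {a..b} \<Longrightarrow> e > 0 \<Longrightarrow>
      \<exists>d>0. \<forall>y\<in>{a..b}. \<bar>y - x\<bar> < d \<longrightarrow> \<bar>H y - H x\<bar> \<le> (f x + e) * \<bar>y - x\<bar>"
  shows "H b - H a \<le> integral {a..b} f"
proof (rule field_le_epsilon)
  fix e :: real assume "e > 0"
  \<comment> \<open>One \<open>e'\<close> is spent on the Riemann sum and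
    \<open>e' * (b - a)\<close> on the increments.\<close>
  define e' where "e' = e / (b - a + 1)"
  have "e' > 0" using \<open>e > 0\<close> \<open>a \<le> b\<close> by (simp add: e'_def)
  have "\<exists>\<gamma>. gauge \<gamma> \<and> (\<forall>p. p tagged_division_of {a..b} \<and> \<gamma> fine p \<longrightarrow>
      norm ((\<Sum>(x,k)\<in>p. measure lborel k *\<^sub>R f x) - integral {a..b} f) < e')"
    using integrable_integral[OF f] \<open>e' > 0\<close> unfolding has_integral_real by simp
  then obtain \<gamma> where \<gamma>: "gauge \<gamma>" "\<And>p. p tagged_division_of {a..b} \<Longrightarrow> \<gamma> fine p \<Longrightarrow>
      norm ((\<Sum>(x,k)\<in>p. measure lborel k *\<^sub>R f x) - integral {a..b} f) < e'"
    by auto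
  have "\<forall>x. \<exists>d>0. x \<in> {a..b} \<longrightarrow> (\<forall>y\<in>{a..b}. \<bar>y - x\<bar> < d \<longrightarrow> \<bar>H y - H x\<bar> \<le> (f x + e') * \<bar>y - x\<bar>)"
    using H[OF _ \<open>e' > 0\<close>] by (meson zero_less_one)
  then obtain d where d: "\<And>x. d x > 0"
    "\<And>x y. x \<in> {a..b} \<Longrightarrow> y \<in> {a..b} \<Longrightarrow> \<bar>y - x\<bar> < d x \<Longrightarrow> \<bar>H y - H x\<bar> \<le> (f x + e') * \<bar>y - x\<bar>"
    by metis
  have "gauge (\<lambda>x. \<gamma> x \<inter> ball x (d x))"
    using \<gamma>(1) gauge_ball_dependent[of d] d(1) by (intro gauge_Int) auto
  then obtain p where p: "p tagged_division_of {a..b}" "(\<lambda>x. \<gamma> x \<inter> ball x (d x)) fine p"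
    using fine_division_exists_real by blast
  then have fp: "\<gamma> fine p" "(\<lambda>x. ball x (d x)) fine p" by (auto simp: fine_Int)
  have "H b - H a = (\<Sum>(x,K)\<in>p. H (Sup K) - H (Inf K))"
    using additive_tagged_division_1[OF \<open>a \<le> b\<close> p(1), of H] by simp
  also have "\<dots> \<le> (\<Sum>(x,K)\<in>p. measure lborel K *\<^sub>R f x + e' * (Sup K - Inf K))"
  proof (rule sum_mono, safe)
    fix x K assume xK: "(x, K) \<in> p"
    then obtain u v where K: "K = {u..v}" and "x \<in> K" and sub: "K \<subseteq> {a..b}"
      using p(1) tagged_division_ofD(2-4)[of p "{a..b}" x K] by (metis interval_cbox)
    then have uv: "u \<le> x" "x \<le> v" by auto
    have "K \<subseteq> ball x (d x)" using fp(2) xK by (auto simp: fine_def)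
    moreover have "u \<in> K" "v \<in> K" using K uv by auto
    ultimately have "u \<in> ball x (d x)" "v \<in> ball x (d x)" by blast+
    then have "\<bar>u - x\<bar> < d x" "\<bar>v - x\<bar> < d x" by (auto simp: dist_real_def)
    then have "\<bar>H u - H x\<bar> \<le> (f x + e') * \<bar>u - x\<bar>" "\<bar>H v - H x\<bar> \<le> (f x + e') * \<bar>v - x\<bar>"
      using sub K uv d(2)[of x u] d(2)[of x v] by auto
    then have "H v - H u \<le> (f x + e') * (v - u)"
      using uv by (simp add: abs_if algebra_simps split: if_splits)
    then show "H (Sup K) - H (Inf K) \<le> measure lborel K *\<^sub>R f x + e' * (Sup K - Inf K)"
      using uv K by (simp add: algebra_simps)
  qed
  also have "\<dots> = (\<Sum>(x,K)\<in>p. measure lborel K *\<^sub>R f x) + e' * (\<Sum>(x,K)\<in>p. Sup K - Inf K)"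
    by (simp add: sum.distrib sum_distrib_left case_prod_unfold)
  also have "(\<Sum>(x,K)\<in>p. Sup K - Inf K) = b - a"
    using additive_tagged_division_1[OF \<open>a \<le> b\<close> p(1), of "\<lambda>x. x"] by simp
  also have "(\<Sum>(x,K)\<in>p. measure lborel K *\<^sub>R f x) + e' * (b - a) \<le> integral {a..b} f + e' + e' * (b - a)"
    using \<gamma>(2)[OF p(1) fp(1)] by simp
  also have "\<dots> = integral {a..b} f + e' * (b - a + 1)" by (simp add: algebra_simps)
  also have "e' * (b - a + 1) = e" using \<open>a \<le> b\<close> by (simp add: e'_def)
  finally show "H b - H a \<le> integral {a..b} f + e" .
qed

text \<open>The indefinite integral of \<open>f\<close> minus \<open>H\<close> is nondecreasing on
  the open interval by the previous lemma; continuity carries the inequality to the two ends in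
  turn.\<close>

lemma straddle_le_integral_interior:
  fixes H f :: "real \<Rightarrow> real"
  assumes "a \<le> b" and f: "f integrable_on {a..b}" and cont: "continuous_on {a..b} H"
    and H: "\<And>x e. x \<in> {a<..<b} \<Longrightarrow> e > 0 \<Longrightarrow>
      \<exists>d>0. \<forall>y\<in>{a..b}. \<bar>y - x\<bar> < d \<longrightarrow> \<bar>H y - H x\<bar> \<le> (f x + e) * \<bar>y - x\<bar>"
  shows "H b - H a \<le> integral {a..b} f"
proof (cases "a = b")
  case False
  then have "a < b" using \<open>a \<le> b\<close> by simp
  define K where "K x = integral {a..x} f - H x" for x
  have contK: "continuous_on {a..b} K"
    unfolding K_def by (intro continuous_intros indefinite_integral_continuous_1 f cont)
  have mono: "K u \<le> K v" if "a < u" "u \<le> v" "v < b" for u v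
  proof -
    have "H v - H u \<le> integral {u..v} f"
    proof (rule straddle_le_integral)
      show "f integrable_on {u..v}" using that by (intro integrable_subinterval_real[OF f]) auto
      fix x e :: real assume "x \<in> {u..v}" "e > 0"
      then show "\<exists>d>0. \<forall>y\<in>{u..v}. \<bar>y - x\<bar> < d \<longrightarrow> \<bar>H y - H x\<bar> \<le> (f x + e) * \<bar>y - x\<bar>"
        using H[of x e] that by fastforce
    qed (use that in auto)
    moreover have "integral {a..u} f + integral {u..v} f = integral {a..v} f"
      using that by (intro Henstock_Kurzweil_Integration.integral_combine integrable_subinterval_real[OF f]) auto
    ultimately show ?thesis by (simp add: K_def)
  qed
  have left: "K a \<le> K v" if "a < v" "v < b" for v
  proof (rule continuous_le_on_closure[where S = "{a<..<v}" and f = K])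
    show "continuous_on (closure {a<..<v}) K"
      using that by (auto intro: continuous_on_subset[OF contK])
  qed (use that mono in auto)
  have "K a \<le> K b"
  proof (rule continuous_ge_on_closure[where S = "{a<..<b}" and f = K])
    show "continuous_on (closure {a<..<b}) K" "b \<in> closure {a<..<b}"
      using \<open>a < b\<close> contK by auto
  qed (use left in auto)
  then show ?thesis by (simp add: K_def)
qed simp

text \<open>The interval is split at the exceptional points one by one. This form fits piecewise C1
  paths.\<close>

lemma straddle_le_integral_finite:
  fixes H f :: "real \<Rightarrow> real"
  assumes "finite X" "a \<le> b" "f integrable_on {a..b}" "continuous_on {a..b} H"
    and "\<And>x e. x \<in> {a..b} - X \<Longrightarrow> e > 0 \<Longrightarrow>
      \<exists>d>0. \<forall>y\<in>{a..b}. \<bar>y - x\<bar> < d \<longrightarrow> \<bar>H y - H x\<bar> \<le> (f x + e) * \<bar>y - x\<bar>"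
  shows "H b - H a \<le> integral {a..b} f"
proof -
  \<comment> \<open>The claim proved by induction asks for the estimate at interior points only, so
    a splitting point, being an end of both halves, is no longer exceptional.\<close>
  have "H b - H a \<le> integral {a..b} f"
    if "a \<le> b" "f integrable_on {a..b}" "continuous_on {a..b} H"
      "\<forall>x e. x \<in> {a<..<b} - X \<and> e > 0 \<longrightarrow>
        (\<exists>d>0. \<forall>y\<in>{a..b}. \<bar>y - x\<bar> < d \<longrightarrow> \<bar>H y - H x\<bar> \<le> (f x + e) * \<bar>y - x\<bar>)"
    using \<open>finite X\<close> that
  proof (induction X arbitrary: a b rule: finite_induct)
    case empty
    then show ?case by (intro straddle_le_integral_interior) auto
  next
    case (insert c X)
    show ?case
    proof (cases "c \<in> {a<..<b}")
      case True
      have "H c - H a \<le> integral {a..c} f"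
      proof (rule insert.IH)
        show "f integrable_on {a..c}"
          using True by (intro integrable_subinterval_real[OF insert.prems(2)]) auto
        show "continuous_on {a..c} H"
          using True by (intro continuous_on_subset[OF insert.prems(3)]) auto
        show "\<forall>x e. x \<in> {a<..<c} - X \<and> e > 0 \<longrightarrow>
          (\<exists>d>0. \<forall>y\<in>{a..c}. \<bar>y - x\<bar> < d \<longrightarrow> \<bar>H y - H x\<bar> \<le> (f x + e) * \<bar>y - x\<bar>)"
        proof (intro allI impI)
          fix x e :: real assume "x \<in> {a<..<c} - X \<and> e > 0"
          then have "\<exists>d>0. \<forall>y\<in>{a..b}. \<bar>y - x\<bar> < d \<longrightarrow> \<bar>H y - H x\<bar> \<le> (f x + e) * \<bar>y - x\<bar>"
            using True insert.prems(4) by auto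
          then show "\<exists>d>0. \<forall>y\<in>{a..c}. \<bar>y - x\<bar> < d \<longrightarrow> \<bar>H y - H x\<bar> \<le> (f x + e) * \<bar>y - x\<bar>"
            using True by auto
        qed
      qed (use True in auto)
      moreover have "H b - H c \<le> integral {c..b} f"
      proof (rule insert.IH)
        show "f integrable_on {c..b}"
          using True by (intro integrable_subinterval_real[OF insert.prems(2)]) auto
        show "continuous_on {c..b} H"
          using True by (intro continuous_on_subset[OF insert.prems(3)]) auto
        show "\<forall>x e. x \<in> {c<..<b} - X \<and> e > 0 \<longrightarrow>
          (\<exists>d>0. \<forall>y\<in>{c..b}. \<bar>y - x\<bar> < d \<longrightarrow> \<bar>H y - H x\<bar> \<le> (f x + e) * \<bar>y - x\<bar>)"
        proof (intro allI impI)
          fix x e :: real assume "x \<in> {c<..<b} - X \<and> e > 0"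
          then have "\<exists>d>0. \<forall>y\<in>{a..b}. \<bar>y - x\<bar> < d \<longrightarrow> \<bar>H y - H x\<bar> \<le> (f x + e) * \<bar>y - x\<bar>"
            using True insert.prems(4) by auto
          then show "\<exists>d>0. \<forall>y\<in>{c..b}. \<bar>y - x\<bar> < d \<longrightarrow> \<bar>H y - H x\<bar> \<le> (f x + e) * \<bar>y - x\<bar>"
            using True by auto
        qed
      qed (use True in auto)
      moreover have "integral {a..c} f + integral {c..b} f = integral {a..b} f"
        using True insert.prems(2) by (intro Henstock_Kurzweil_Integration.integral_combine) auto
      ultimately show ?thesis by simp
    next
      case False
      then show ?thesis using insert.prems by (intro insert.IH) auto
    qed
  qed
  then show ?thesis using assms by auto
qed

section \<open>Smoothing a Lipschitz function with fixed end values\<close>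

text \<open>The average of \<open>h\<close> over a moving window of length \<open>e\<close> has a
  difference quotient of \<open>h\<close> as derivative, which is at most 1 in modulus; an affine
  correction of slope at most 1 restores the end values.\<close>

lemma lipschitz_C1_approximation:
  fixes h :: "real \<Rightarrow> real"
  assumes lip: "\<And>u v. \<bar>h u - h v\<bar> \<le> \<bar>u - v\<bar>" and "s < t" "\<eta> > 0"
  obtains q q' where "q s = h s" "q t = h t"
    "\<And>u. u \<in> {s..t} \<Longrightarrow> (q has_real_derivative q' u) (at u)"
    "continuous_on {s..t} q'"
    "\<And>u. u \<in> {s..t} \<Longrightarrow> \<bar>q' u\<bar> \<le> 2"
    "\<And>u. u \<in> {s..t} \<Longrightarrow> \<bar>q u - h u\<bar> \<le> \<eta>"
proof -
  have conth: "continuous_on X h" for X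
  proof (rule continuous_on_subset)
    show "continuous_on UNIV h"
      using lip by (intro lipschitz_on_continuous_on[of 1] lipschitz_onI) (auto simp: dist_real_def)
  qed simp
  \<comment> \<open>The first bound keeps the slope \<open>\<beta>\<close>, of modulus at most 2e/(t
    - s), below 1. The second covers the total error: e from averaging, e from
    \<open>\<alpha>\<close>, 2e from the linear term.\<close>
  define e where "e = min ((t - s) / 2) (\<eta> / 4)"
  have e: "e > 0" "e \<le> (t - s) / 2" "4 * e \<le> \<eta>" using \<open>s < t\<close> \<open>\<eta> > 0\<close> by (auto simp: e_def min_def)
  \<comment> \<open>Starting to the left of \<open>s\<close> makes the derivative two-sided at
    \<open>s\<close> as well.\<close>
  define P where "P u = integral {s-1..u} h" for u
  have P: "(P has_real_derivative h u) (at u)" if "u \<in> {s..t+e}" for u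
  proof -
    have "(P has_real_derivative h u) (at u within {s-1..t+e+1})"
      unfolding P_def using that e by (intro integral_has_real_derivative conth) auto
    moreover have "at u within {s-1..t+e+1} = at u"
      using that e by (intro at_within_interior) auto
    ultimately show ?thesis by simp
  qed
  define m where "m u = (P (u + e) - P u) / e" for u
  have m: "(m has_real_derivative (h (u + e) - h u) / e) (at u)" if "u \<in> {s..t}" for u
  proof -
    have "((\<lambda>u. P (u + e)) has_real_derivative h (u + e)) (at u)"
      using P[of "u + e"] that e by (simp add: DERIV_shift)
    then show ?thesis
      unfolding m_def using P[of u] that e by (auto intro!: derivative_eq_intros)
  qed
  have mh: "\<bar>m u - h u\<bar> \<le> e" if u: "u \<in> {s..t}" for u
  proof -
    have "\<exists>z>u. z < u + e \<and> P (u + e) - P u = (u + e - u) * h z"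
      using P u e by (intro MVT2) auto
    then obtain z where z: "u < z" "z < u + e" "P (u + e) - P u = (u + e - u) * h z"
      by auto
    then have "m u = h z" using e by (simp add: m_def)
    then show ?thesis using lip[of z u] z by simp
  qed
  define \<alpha> where "\<alpha> = h s - m s"
  define \<beta> where "\<beta> = ((h t - m t) - (h s - m s)) / (t - s)"
  define q where "q u = m u + \<alpha> + \<beta> * (u - s)" for u
  define q' where "q' u = (h (u + e) - h u) / e + \<beta>" for u
  have \<alpha>: "\<bar>\<alpha>\<bar> \<le> e" using mh[of s] \<open>s < t\<close> by (simp add: \<alpha>_def)
  have \<beta>': "\<bar>\<beta>\<bar> * (t - s) \<le> 2 * e"
    using mh[of s] mh[of t] \<open>s < t\<close> by (simp add: \<beta>_def)
  have \<beta>: "\<bar>\<beta>\<bar> \<le> 1"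
  proof -
    have "\<bar>\<beta>\<bar> * (t - s) \<le> 1 * (t - s)" using \<beta>' e by linarith
    then show ?thesis using \<open>s < t\<close> by (simp only: mult_le_cancel_right_pos diff_gt_0_iff_gt)
  qed
  show ?thesis
  proof (rule that[of q q'])
    show "q s = h s" "q t = h t" using \<open>s < t\<close> by (simp_all add: q_def \<alpha>_def \<beta>_def)
    show "continuous_on {s..t} q'"
      unfolding q'_def using e
      by (intro continuous_intros continuous_on_compose2[OF conth[of UNIV]]) auto
    fix u assume u: "u \<in> {s..t}"
    show "(q has_real_derivative q' u) (at u)"
      unfolding q_def q'_def using m[OF u] by (auto intro!: derivative_eq_intros)
    have "\<bar>(h (u + e) - h u) / e\<bar> \<le> 1" using lip[of "u + e" u] e by simp
    then show "\<bar>q' u\<bar> \<le> 2" using \<beta> unfolding q'_def by linarith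
    have "\<bar>\<beta> * (u - s)\<bar> \<le> \<bar>\<beta>\<bar> * (t - s)"
      using u by (auto simp: abs_mult intro!: mult_left_mono)
    then show "\<bar>q u - h u\<bar> \<le> \<eta>"
      using \<alpha> \<beta>' mh[OF u] e unfolding q_def by linarith
  qed
qed

section \<open>Domains closed under upward translation\<close>

locale upward_domain =
  fixes \<Omega> :: "complex set"
  assumes openO: "open \<Omega>" and connO: "connected \<Omega>"
    and up: "\<And>z t. z \<in> \<Omega> \<Longrightarrow> t \<ge> 0 \<Longrightarrow> z + \<i> * of_real t \<in> \<Omega>"
    and zero: "0 \<notin> \<Omega>"
    and axis: "\<And>t. t > 0 \<Longrightarrow> Complex 0 t \<in> \<Omega>"
begin

section \<open>Distances from the axis to the two sides of the complement\<close>

lemma upI: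
  assumes "z \<in> \<Omega>" "Re w = Re z" "Im z \<le> Im w"
  shows "w \<in> \<Omega>"
proof -
  have "w = z + \<i> * of_real (Im w - Im z)" using assms by (simp add: complex_eq_iff)
  then show ?thesis using up[of z "Im w - Im z"] assms by simp
qed

text \<open>Only \<open>s = 1\<close> and \<open>s = -1\<close> are of interest: they give the two sides of the imaginary axis.\<close>

definition side :: "real \<Rightarrow> complex set" where
  "side s = {z. z \<notin> \<Omega> \<and> s * Re z \<ge> 0}"

text \<open>Since 0 lies in \<open>side s\<close>, this is at most \<open>t\<close> for t \<ge> 0,
  and so equals \<open>delta_plus\<close> for s = 1 and \<open>delta_minus\<close> for s =
  -1.\<close>

definition D :: "real \<Rightarrow> real \<Rightarrow> real" where
  "D s t = infdist (Complex 0 t) (side s)"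

definition width :: "real \<Rightarrow> real" where
  "width t = D 1 t + D (-1) t"

definition shift :: "real \<Rightarrow> real" where
  "shift t = (D 1 t - D (-1) t) / 2"

lemma zero_in_side: "0 \<in> side s"
  using zero by (simp add: side_def)

lemma closed_side: "closed (side s)"
proof -
  have "side s = - \<Omega> \<inter> {z. s * Re z \<ge> 0}" by (auto simp: side_def)
  moreover have "closed {z. s * Re z \<ge> 0}" by (intro closed_Collect_le continuous_intros)
  ultimately show ?thesis using openO by (simp add: closed_Int closed_Compl)
qed

lemma D_le_dist: "z \<notin> \<Omega> \<Longrightarrow> s * Re z \<ge> 0 \<Longrightarrow> D s t \<le> dist (Complex 0 t) z"
  unfolding D_def by (rule infdist_le) (simp add: side_def)

lemma D_attained:
  obtains p where "p \<notin> \<Omega>" "s * Re p \<ge> 0" "dist (Complex 0 t) p = D s t"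
  using infdist_attains_inf[OF closed_side, of s "Complex 0 t"] zero_in_side
  by (metis (mono_tags, lifting) D_def empty_iff mem_Collect_eq side_def)

lemma D_nonneg: "D s t \<ge> 0"
  by (simp add: D_def infdist_nonneg)

lemma D_lipschitz: "\<bar>D s u - D s v\<bar> \<le> \<bar>u - v\<bar>"
proof -
  have "dist (Complex 0 u) (Complex 0 v) = \<bar>u - v\<bar>"
    by (simp add: dist_complex_def cmod_def)
  then show ?thesis
    unfolding D_def by (metis infdist_triangle_abs)
qed

lemma D_le: "t \<ge> 0 \<Longrightarrow> D s t \<le> t"
  using D_le_dist[OF zero, of s t] by (simp add: dist_complex_def cmod_def)

lemma D_pos:
  assumes "t > 0"
  shows "D s t > 0"
proof -
  obtain p where "p \<notin> \<Omega>" "dist (Complex 0 t) p = D s t" by (rule D_attained)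
  then show ?thesis using axis[OF assms] by (metis zero_less_dist_iff)
qed

text \<open>The complement is closed under downward translation, so a nearest point for
  \<open>v\<close>, lowered by \<open>v - u\<close>, competes in the distance for
  \<open>u\<close>.\<close>

lemma D_mono:
  assumes "u \<le> v"
  shows "D s u \<le> D s v"
proof -
  obtain p where p: "p \<notin> \<Omega>" "s * Re p \<ge> 0" "dist (Complex 0 v) p = D s v" by (rule D_attained)
  define q where "q = Complex (Re p) (Im p - (v - u))"
  have "q \<notin> \<Omega>"
  proof
    assume "q \<in> \<Omega>"
    then have "p \<in> \<Omega>" by (rule upI) (use assms in \<open>simp_all add: q_def\<close>)
    then show False using p(1) by contradiction
  qed
  then have "D s u \<le> dist (Complex 0 u) q" using p(2) by (intro D_le_dist) (simp_all add: q_def)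
  also have "Complex 0 u - q = Complex 0 v - p" by (simp add: q_def complex_eq_iff)
  then have "dist (Complex 0 u) q = D s v" using p by (simp add: dist_norm)
  finally show ?thesis .
qed

lemma delta_plus_eq: "t \<ge> 0 \<Longrightarrow> delta_plus \<Omega> t = D 1 t"
proof -
  assume t: "t \<ge> 0"
  have "D 1 t = (INF z\<in>side 1. dist (Complex 0 t) z)"
    unfolding D_def using zero_in_side by (intro infdist_notempty) auto
  also have "\<dots> = (INF z\<in>{z. z \<notin> \<Omega> \<and> Re z \<ge> 0}. cmod (z - \<i> * of_real t))"
    by (simp add: side_def dist_norm norm_minus_commute Complex_eq)
  finally show ?thesis using D_le[OF t, of 1] by (simp add: delta_plus_def)
qed

lemma delta_minus_eq: "t \<ge> 0 \<Longrightarrow> delta_minus \<Omega> t = D (-1) t"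
proof -
  assume t: "t \<ge> 0"
  have "D (-1) t = (INF z\<in>side (-1). dist (Complex 0 t) z)"
    unfolding D_def using zero_in_side by (intro infdist_notempty) auto
  also have "\<dots> = (INF z\<in>{z. z \<notin> \<Omega> \<and> Re z \<le> 0}. cmod (z - \<i> * of_real t))"
    by (simp add: side_def dist_norm norm_minus_commute Complex_eq)
  finally show ?thesis using D_le[OF t, of "-1"] by (simp add: delta_minus_def)
qed

lemma width_lipschitz: "\<bar>width u - width v\<bar> \<le> 2 * \<bar>u - v\<bar>"
  using D_lipschitz[of 1 u v] D_lipschitz[of "-1" u v] unfolding width_def by (auto simp: abs_le_iff)

lemma width_mono: "u \<le> v \<Longrightarrow> width u \<le> width v"
  using D_mono[of u v 1] D_mono[of u v "-1"] unfolding width_def by linarith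

lemma width_pos: "t > 0 \<Longrightarrow> width t > 0"
  using D_pos[of t 1] D_pos[of t "-1"] unfolding width_def by linarith

lemma width_le: "t \<ge> 0 \<Longrightarrow> width t \<le> 2 * t"
  using D_le[of t 1] D_le[of t "-1"] unfolding width_def by linarith

lemma D_le_width: "D 1 t \<le> width t" "D (-1) t \<le> width t"
  using D_nonneg[of 1 t] D_nonneg[of "-1" t] unfolding width_def by linarith+

lemma shift_lipschitz: "\<bar>shift u - shift v\<bar> \<le> \<bar>u - v\<bar>"
  using D_lipschitz[of 1 u v] D_lipschitz[of "-1" u v] unfolding shift_def by (auto simp: abs_le_iff field_simps)

lemma abs_shift_le: "\<bar>shift t\<bar> \<le> width t / 2"
  using D_nonneg[of 1 t] D_nonneg[of "-1" t] unfolding width_def shift_def by (auto simp: abs_le_iff)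

text \<open>Take \<open>z\<close> in the complement. On the side towards which the centre is
  displaced, the triangle inequality puts \<open>z\<close> at distance at least
  \<open>width t / 2\<close>. On the other side the angle at the axis point is not acute, so the
  squared distance is at least D^2 + k^2, where D + k = \<open>width t / 2\<close>; this is at least
  (width t)^2 / 8.\<close>

lemma ball_shift_subset: "ball (Complex (shift t) t) (width t / 3) \<subseteq> \<Omega>"
proof
  fix z assume "z \<in> ball (Complex (shift t) t) (width t / 3)"
  then have lt: "dist (Complex (shift t) t) z < width t / 3" by simp
  show "z \<in> \<Omega>"
  proof (rule ccontr)
    assume "z \<notin> \<Omega>"
    have contra: False if s: "s * Re z \<ge> 0" "s = 1 \<or> s = -1" for s :: real
    proof -
      have Ds: "D s t \<le> dist (Complex 0 t) z" using D_le_dist \<open>z \<notin> \<Omega>\<close> s by simp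
      show False
      proof (cases "s * shift t \<ge> 0")
        case True
        then have "D s t - \<bar>shift t\<bar> = width t / 2"
          using s(2) by (auto simp: shift_def width_def field_simps)
        moreover have "dist (Complex 0 t) (Complex (shift t) t) = \<bar>shift t\<bar>"
          by (simp add: dist_complex_def cmod_def)
        ultimately show False
          using lt Ds dist_triangle[of "Complex 0 t" z "Complex (shift t) t"] abs_shift_le[of t]
          by linarith
      next
        case False
        define k where "k = \<bar>shift t\<bar>"
        have w: "D s t + k = width t / 2"
          using False s(2) by (auto simp: k_def shift_def width_def field_simps)
        have "Re z * shift t \<le> 0"
          using False s by (auto simp: mult_le_0_iff zero_le_mult_iff)
        have "(dist (Complex (shift t) t) z)\<^sup>2 = (dist (Complex 0 t) z)\<^sup>2 + k\<^sup>2 - 2 * (Re z * shift t)"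
          unfolding dist_complex_def cmod_power2 k_def by (simp add: power2_eq_square algebra_simps)
        moreover have "(D s t)\<^sup>2 \<le> (dist (Complex 0 t) z)\<^sup>2"
          using Ds D_nonneg by (intro power_mono) auto
        moreover have "(dist (Complex (shift t) t) z)\<^sup>2 < (width t / 3)\<^sup>2"
          using lt by (intro power_strict_mono) auto
        ultimately have "(D s t)\<^sup>2 + k\<^sup>2 < (width t / 3)\<^sup>2"
          using \<open>Re z * shift t \<le> 0\<close> by linarith
        moreover have "width t = 2 * (D s t + k)" using w by simp
        \<comment> \<open>An explicit sum of squares shows that D^2 + k^2 is at least the square of
          a third of the width.\<close>
        then have "9 * ((D s t)\<^sup>2 + k\<^sup>2 - (width t / 3)\<^sup>2) = 4 * (D s t - k)\<^sup>2 + (D s t)\<^sup>2 + k\<^sup>2"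
          by (simp add: power2_eq_square field_simps)
        then have "0 \<le> (D s t)\<^sup>2 + k\<^sup>2 - (width t / 3)\<^sup>2"
          by (smt (verit) zero_le_power2)
        ultimately show False by simp
      qed
    qed
    show False
      using contra[of 1] contra[of "-1"] by (cases "Re z \<ge> 0") auto
  qed
qed

section \<open>Horizontal access to the axis, and extension of the parameter to the domain\<close>

text \<open>As both distances are positive, |shift t| is strictly less than the distance from the
  axis point at height \<open>t\<close> to the complement on the side of the shift.\<close>

lemma segment_shift:
  assumes "t > 0" "\<xi> \<in> closed_segment 0 (shift t)"
  shows "Complex \<xi> t \<in> \<Omega>"
proof (rule ccontr)
  assume n: "Complex \<xi> t \<notin> \<Omega>"
  have pos: "D 1 t > 0" "D (-1) t > 0" using D_pos assms by auto
  have d: "dist (Complex 0 t) (Complex \<xi> t) = \<bar>\<xi>\<bar>" by (simp add: dist_complex_def cmod_def)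
  show False
  proof (cases "shift t \<ge> 0")
    case True
    then have "0 \<le> \<xi>" "\<xi> \<le> shift t" using assms by (auto simp: closed_segment_eq_real_ivl)
    then show False using D_le_dist[OF n, of 1 t] d pos by (simp add: shift_def field_simps)
  next
    case False
    then have "\<xi> \<le> 0" "shift t \<le> \<xi>" using assms by (auto simp: closed_segment_eq_real_ivl)
    then show False using D_le_dist[OF n, of "-1" t] d pos by (simp add: shift_def field_simps)
  qed
qed

text \<open>A point of the domain can always climb vertically; these are the heights from which it
  can then cross horizontally to the axis. \<open>level\<close> is their infimum, which may fail to
  be attained.\<close>

definition levels :: "complex \<Rightarrow> real set" where
  "levels z = {w. Im z \<le> w \<and> (\<forall>\<xi>\<in>closed_segment 0 (Re z). Complex \<xi> w \<in> \<Omega>)}"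

definition level :: "complex \<Rightarrow> real" where
  "level z = Inf (levels z)"

text \<open>The crossing for \<open>z'\<close> is covered by the one for \<open>z\<close> and the
  segment between the two real parts, and both may be raised to any height above
  \<open>w\<close>.\<close>

lemma levels_step:
  assumes w: "w \<in> levels z" and seg: "\<And>\<xi>. \<xi> \<in> closed_segment (Re z) (Re z') \<Longrightarrow> Complex \<xi> (Im z) \<in> \<Omega>"
  shows "max w (Im z') \<in> levels z'"
proof -
  have "Complex \<xi> (max w (Im z')) \<in> \<Omega>" if "\<xi> \<in> closed_segment 0 (Re z')" for \<xi>
  proof (cases "\<xi> \<in> closed_segment 0 (Re z)")
    case True
    then show ?thesis using w upI[of "Complex \<xi> w"] by (auto simp: levels_def)
  next
    case False
    then have "\<xi> \<in> closed_segment (Re z) (Re z')"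
      using that by (auto simp: closed_segment_eq_real_ivl split: if_splits)
    then show ?thesis using upI[OF seg] w by (auto simp: levels_def)
  qed
  then show ?thesis by (simp add: levels_def)
qed

lemma horizontal_in_ball:
  assumes "dist z z' < r" "\<xi> \<in> closed_segment (Re z) (Re z')"
  shows "Complex \<xi> (Im z) \<in> ball z r" "Complex \<xi> (Im z') \<in> ball z r"
proof -
  have le: "\<bar>\<xi> - Re z\<bar> \<le> \<bar>Re z' - Re z\<bar>"
    using assms(2) by (auto simp: closed_segment_eq_real_ivl split: if_splits)
  have "dist z (Complex \<xi> (Im z)) = \<bar>\<xi> - Re z\<bar>"
    by (simp add: dist_complex_def cmod_def)
  then show "Complex \<xi> (Im z) \<in> ball z r"
    using le assms(1) abs_Re_le_cmod[of "z' - z"] by (simp add: dist_norm norm_minus_commute)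
  have "(\<xi> - Re z)\<^sup>2 \<le> (Re z' - Re z)\<^sup>2" using le by (simp add: abs_le_square_iff)
  then have "dist z (Complex \<xi> (Im z')) \<le> dist z z'"
    unfolding dist_complex_def cmod_def by (simp add: power2_commute)
  then show "Complex \<xi> (Im z') \<in> ball z r" using assms(1) by simp
qed

text \<open>Whether a crossing height exists is locally constant on the domain, so connectedness
  propagates it from a point of the axis, where the segment is degenerate.\<close>

lemma levels_nonempty:
  assumes "z \<in> \<Omega>"
  shows "levels z \<noteq> {}"
proof (rule connected_induction_simple[OF connO, of "Complex 0 1" z])
  show "levels (Complex 0 1) \<noteq> {}" using axis[of 1] by (auto simp: levels_def)
  show "Complex 0 1 \<in> \<Omega>" using axis[of 1] by simp
  fix a assume "a \<in> \<Omega>"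
  then obtain r where r: "r > 0" "ball a r \<subseteq> \<Omega>" using openO by (auto elim: openE)
  \<comment> \<open>With \<open>x\<close> and \<open>y\<close> within r/3 of \<open>a\<close>, the
    horizontal segment from \<open>x\<close> stays within 2r/3 of \<open>x\<close>, hence within
    \<open>r\<close> of \<open>a\<close>.\<close>
  have "levels y \<noteq> {}" if xy: "x \<in> ball a (r/3)" "y \<in> ball a (r/3)" and ne: "levels x \<noteq> {}" for x y
  proof -
    obtain w where w: "w \<in> levels x" using ne by auto
    have d: "dist x y < 2 * r / 3"
      using xy dist_triangle[of x y a] by (simp add: dist_commute)
    have "max w (Im y) \<in> levels y"
    proof (rule levels_step[OF w])
      fix \<xi> assume "\<xi> \<in> closed_segment (Re x) (Re y)"
      then have "Complex \<xi> (Im x) \<in> ball x (2 * r / 3)" by (rule horizontal_in_ball(1)[OF d])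
      then have "Complex \<xi> (Im x) \<in> ball a r"
        using xy dist_triangle[of a "Complex \<xi> (Im x)" x] by simp
      then show "Complex \<xi> (Im x) \<in> \<Omega>" using r by auto
    qed
    then show ?thesis by auto
  qed
  moreover have "openin (top_of_set \<Omega>) (ball a (r/3))"
    using r openO by (subst openin_open_eq) (auto simp: subset_iff)
  ultimately show "\<exists>T. openin (top_of_set \<Omega>) T \<and> a \<in> T \<and> (\<forall>x\<in>T. \<forall>y\<in>T. levels x \<noteq> {} \<longrightarrow> levels y \<noteq> {})"
    using r(1) by (intro exI[of _ "ball a (r/3)"] conjI ballI impI) (assumption | simp only: centre_in_ball zero_less_divide_iff zero_less_numeral simp_thms)+
qed (use assms in auto)

lemma bdd_below_levels: "bdd_below (levels z)"
  by (intro bdd_belowI[of _ "Im z"]) (auto simp: levels_def)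

lemma level_ge: "z \<in> \<Omega> \<Longrightarrow> Im z \<le> level z"
  unfolding level_def by (intro cInf_greatest levels_nonempty) (auto simp: levels_def)

lemma level_le_step:
  assumes "z \<in> \<Omega>" and seg: "\<And>\<xi>. \<xi> \<in> closed_segment (Re z) (Re z') \<Longrightarrow> Complex \<xi> (Im z) \<in> \<Omega>"
  shows "level z' \<le> level z + \<bar>Im z' - Im z\<bar>"
proof -
  have "level z' - \<bar>Im z' - Im z\<bar> \<le> Inf (levels z)"
  proof (rule cInf_greatest[OF levels_nonempty[OF assms(1)]])
    fix w assume w: "w \<in> levels z"
    have "level z' \<le> max w (Im z')"
      unfolding level_def by (intro cInf_lower levels_step[OF w seg] bdd_below_levels)
    also have "\<dots> \<le> w + \<bar>Im z' - Im z\<bar>" using w by (auto simp: levels_def)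
    finally show "level z' - \<bar>Im z' - Im z\<bar> \<le> w" by simp
  qed
  then show ?thesis by (simp add: level_def)
qed

text \<open>The horizontal segments through \<open>z\<close> and through \<open>z'\<close> between
  the two real parts lie in the ball, so \<open>level_le_step\<close> applies in both directions.
  Horizontal moves inside the ball leave the level unchanged.\<close>

lemma level_lipschitz:
  assumes r: "ball z r \<subseteq> \<Omega>" and d: "dist z z' < r"
  shows "\<bar>level z' - level z\<bar> \<le> \<bar>Im z' - Im z\<bar>"
proof -
  have "r > 0" using d by (smt (verit) zero_le_dist)
  then have "z \<in> \<Omega>" "z' \<in> \<Omega>" using r d by auto
  have "level z' \<le> level z + \<bar>Im z' - Im z\<bar>"
    using horizontal_in_ball(1)[OF d] r by (intro level_le_step \<open>z \<in> \<Omega>\<close>) auto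
  moreover have "level z \<le> level z' + \<bar>Im z - Im z'\<bar>"
    using horizontal_in_ball(2)[OF d] r by (intro level_le_step \<open>z' \<in> \<Omega>\<close>) (auto simp: closed_segment_commute)
  ultimately show ?thesis by linarith
qed

text \<open>The parameter assigned to a point of the domain: displacement by \<open>x\<close> from the axis counts
  like moving up the axis by \<open>x\<close>, because the width grows at unit speed above any horizontal
  segment contained in the domain.\<close>

definition param :: "complex \<Rightarrow> real" where
  "param z = max 1 (level z + \<bar>Re z\<bar>)"

lemma param_ge_1: "param z \<ge> 1"
  by (simp add: param_def)

lemma param_lipschitz:
  assumes "ball z r \<subseteq> \<Omega>" "dist z z' < r"
  shows "\<bar>param z' - param z\<bar> \<le> 2 * dist z z'"
proof -
  have "\<bar>level z' - level z\<bar> \<le> dist z z'" "\<bar>Re z' - Re z\<bar> \<le> dist z z'"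
    using level_lipschitz[OF assms] abs_Re_le_cmod[of "z' - z"] abs_Im_le_cmod[of "z' - z"]
    by (simp_all add: dist_norm norm_minus_commute)
  then show ?thesis unfolding param_def by (simp add: max_def abs_if split: if_splits)
qed

text \<open>If the segment from the axis to \<open>Re z\<close> at height \<open>w\<close> lies in
  the domain, so does everything above it, in particular the half-disc of radius
  \<open>\<bar>Re z\<bar>\<close> about the axis point at height \<open>w + \<bar>Re z\<bar>\<close>
  on the side of \<open>z\<close>.\<close>

lemma abs_Re_le_width:
  assumes "z \<in> \<Omega>"
  shows "\<bar>Re z\<bar> \<le> width (level z + \<bar>Re z\<bar>)"
proof -
  define s :: real where "s = (if Re z \<ge> 0 then 1 else -1)"
  \<comment> \<open>The infimum need not be attained; the Lipschitz bound on \<open>D\<close> pays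
    for the gap \<open>w - level z\<close>.\<close>
  have "\<bar>Re z\<bar> - D s (level z + \<bar>Re z\<bar>) + level z \<le> Inf (levels z)"
  proof (rule cInf_greatest[OF levels_nonempty[OF assms(1)]])
    fix w assume w: "w \<in> levels z"
    have lw: "level z \<le> w" unfolding level_def by (intro cInf_lower w bdd_below_levels)
    have "\<bar>Re z\<bar> \<le> D s (w + \<bar>Re z\<bar>)"
    proof (rule ccontr)
      assume n: "\<not> ?thesis"
      obtain p where p: "p \<notin> \<Omega>" "s * Re p \<ge> 0" "dist (Complex 0 (w + \<bar>Re z\<bar>)) p = D s (w + \<bar>Re z\<bar>)"
        by (rule D_attained)
      have "\<bar>Re p\<bar> < \<bar>Re z\<bar>" "\<bar>w + \<bar>Re z\<bar> - Im p\<bar> < \<bar>Re z\<bar>"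
        using n p(3) abs_Re_le_cmod[of "Complex 0 (w + \<bar>Re z\<bar>) - p"]
          abs_Im_le_cmod[of "Complex 0 (w + \<bar>Re z\<bar>) - p"] by (auto simp: dist_norm)
      then have "Im p > w" "Re p \<in> closed_segment 0 (Re z)"
        using p(2) by (auto simp: s_def closed_segment_eq_real_ivl split: if_splits)
      then have "p \<in> \<Omega>" using w upI[of "Complex (Re p) w" p] by (auto simp: levels_def)
      then show False using p by simp
    qed
    also have "\<dots> \<le> D s (level z + \<bar>Re z\<bar>) + (w - level z)"
      using D_lipschitz[of s "w + \<bar>Re z\<bar>" "level z + \<bar>Re z\<bar>"] lw by simp
    finally show "\<bar>Re z\<bar> - D s (level z + \<bar>Re z\<bar>) + level z \<le> w" by simp
  qed
  then have "\<bar>Re z\<bar> \<le> D s (level z + \<bar>Re z\<bar>)" by (simp add: level_def[symmetric])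
  also have "\<dots> \<le> width (level z + \<bar>Re z\<bar>)" using D_le_width by (simp add: s_def)
  finally show ?thesis .
qed

text \<open>If the level of \<open>z\<close> is its own height, go to the axis point at height
  \<open>u\<close>, at distance at most 2|Re z|, and from there to the complement. Otherwise the
  horizontal segment from \<open>z\<close> to the axis is blocked by a point of the
  complement.\<close>

lemma complement_within_width:
  assumes "z \<in> \<Omega>"
  obtains p where "p \<notin> \<Omega>" "dist z p \<le> 3 * width (param z)"
proof -
  define u where "u = level z + \<bar>Re z\<bar>"
  have x: "\<bar>Re z\<bar> \<le> width u" unfolding u_def by (rule abs_Re_le_width[OF assms])
  have wu: "width u \<le> width (param z)" by (intro width_mono) (simp add: u_def param_def)
  show ?thesis
  proof (cases "level z = Im z")
    case True
    obtain p where p: "p \<notin> \<Omega>" "dist (Complex 0 u) p = D 1 u" by (rule D_attained)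
    have "dist z (Complex 0 u) \<le> \<bar>Re z\<bar> + \<bar>Im z - u\<bar>"
      using cmod_le[of "z - Complex 0 u"] by (simp add: dist_norm)
    also have "\<dots> = 2 * \<bar>Re z\<bar>" using True by (simp add: u_def)
    finally have "dist z p \<le> 3 * width u"
      using dist_triangle[of z p "Complex 0 u"] p x D_le_width(1)[of u] by linarith
    then show ?thesis using that[OF p(1)] wu by linarith
  next
    case False
    then have "Im z < level z" using level_ge[OF assms] by simp
    then have "Im z \<notin> levels z"
      unfolding level_def using cInf_lower[OF _ bdd_below_levels] by (metis linorder_not_less)
    then obtain \<xi> where \<xi>: "\<xi> \<in> closed_segment 0 (Re z)" "Complex \<xi> (Im z) \<notin> \<Omega>"
      by (auto simp: levels_def)
    have "dist z (Complex \<xi> (Im z)) = \<bar>Re z - \<xi>\<bar>" by (simp add: dist_complex_def cmod_def)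
    also have "\<dots> \<le> \<bar>Re z\<bar>" using \<xi>(1) by (auto simp: closed_segment_eq_real_ivl split: if_splits)
    finally show ?thesis using that[OF \<xi>(2)] wu x by linarith
  qed
qed

text \<open>By \<open>segment_shift\<close> the point of the curve at height \<open>t\<close> has
  level exactly \<open>t\<close>, so only |shift t| is added.\<close>

lemma param_shift:
  assumes "t \<ge> 1"
  shows "t \<le> param (Complex (shift t) t)" "param (Complex (shift t) t) \<le> t + width t / 2"
proof -
  have "t \<in> levels (Complex (shift t) t)"
    using segment_shift[of t] assms by (simp add: levels_def)
  then have "level (Complex (shift t) t) = t"
    unfolding level_def by (intro cInf_eq_minimum) (auto simp: levels_def)
  then show "t \<le> param (Complex (shift t) t)" "param (Complex (shift t) t) \<le> t + width t / 2"
    using abs_shift_le[of t] assms by (auto simp: param_def)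
qed

section \<open>The integral of the inverse width\<close>

lemma continuous_on_width: "continuous_on X width"
proof (rule continuous_on_subset)
  show "continuous_on UNIV width"
    using width_lipschitz by (intro lipschitz_on_continuous_on[of 2] lipschitz_onI) (auto simp: dist_real_def)
qed simp

definition \<Lambda> :: "real \<Rightarrow> real" where
  "\<Lambda> t = integral {1..t} (\<lambda>u. 1 / width u)"

lemma continuous_on_inverse_width:
  assumes "X \<subseteq> {1..}"
  shows "continuous_on X (\<lambda>u. 1 / width u)"
proof (intro continuous_on_divide continuous_on_const continuous_on_width ballI)
  fix u assume "u \<in> X"
  then show "width u \<noteq> 0" using assms width_pos[of u] by auto
qed

lemma \<Lambda>_1 [simp]: "\<Lambda> 1 = 0"
  by (simp add: \<Lambda>_def)

lemma \<Lambda>_diff: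
  assumes "1 \<le> s" "s \<le> t"
  shows "\<Lambda> t - \<Lambda> s = integral {s..t} (\<lambda>u. 1 / width u)"
proof -
  have "\<Lambda> s + integral {s..t} (\<lambda>u. 1 / width u) = \<Lambda> t"
    unfolding \<Lambda>_def using assms
    by (intro Henstock_Kurzweil_Integration.integral_combine integrable_continuous_real continuous_on_inverse_width) auto
  then show ?thesis by simp
qed

lemma \<Lambda>_diff_le:
  assumes "1 \<le> s" "s \<le> t"
  shows "\<Lambda> t - \<Lambda> s \<le> (t - s) / width s"
proof -
  have "integral {s..t} (\<lambda>u. 1 / width u) \<le> integral {s..t} (\<lambda>u. 1 / width s)"
    using assms width_mono width_pos[of s]
    by (intro integral_le integrable_continuous_real continuous_on_inverse_width) (auto intro!: divide_left_mono mult_pos_pos width_pos)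
  then show ?thesis using assms by (simp add: \<Lambda>_diff)
qed

lemma \<Lambda>_diff_ge:
  assumes "1 \<le> s" "s \<le> t"
  shows "(t - s) / width t \<le> \<Lambda> t - \<Lambda> s"
proof -
  have "integral {s..t} (\<lambda>u. 1 / width t) \<le> integral {s..t} (\<lambda>u. 1 / width u)"
    using assms width_mono width_pos
    by (intro integral_le integrable_continuous_real continuous_on_inverse_width) (auto intro!: divide_left_mono mult_pos_pos width_pos)
  then show ?thesis using assms by (simp add: \<Lambda>_diff)
qed

lemma \<Lambda>_mono: "1 \<le> s \<Longrightarrow> s \<le> t \<Longrightarrow> \<Lambda> s \<le> \<Lambda> t"
  using \<Lambda>_diff_ge[of s t] width_pos[of t] by (smt (verit) divide_nonneg_nonneg)

lemma \<Lambda>_strict_mono: "1 \<le> s \<Longrightarrow> s < t \<Longrightarrow> \<Lambda> s < \<Lambda> t"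
  using \<Lambda>_diff_ge[of s t] width_pos[of t] by (smt (verit) divide_pos_pos)

lemma \<Lambda>_has_derivative:
  assumes "1 \<le> t" "t \<le> b"
  shows "(\<Lambda> has_real_derivative 1 / width t) (at t within {1..b})"
  unfolding \<Lambda>_def using assms by (intro integral_has_real_derivative continuous_on_inverse_width) auto

lemma continuous_on_\<Lambda>: "continuous_on {1..} \<Lambda>"
proof -
  have "continuous_on {1..b} \<Lambda>" for b
    using \<Lambda>_has_derivative[of _ b] by (intro DERIV_continuous_on) auto
  then have "continuous (at t within {1..t+1}) \<Lambda>" if "t \<ge> 1" for t
    using that by (auto simp: continuous_on_eq_continuous_within)
  moreover have "at t within {1..t+1} = at t within {1..}" for t :: real
    by (rule at_within_nhd[of _ "{..<t+1}"]) auto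
  ultimately show ?thesis
    by (auto simp: continuous_on_eq_continuous_within)
qed

text \<open>Since the width is at most twice the height, each dyadic block contributes at least
  1/4.\<close>

lemma \<Lambda>_unbounded: "real n / 4 \<le> \<Lambda> (2 ^ n)"
proof (induction n)
  case (Suc n)
  have "width (2 ^ Suc n) \<le> 4 * 2 ^ n" using width_le[of "2 ^ Suc n"] by simp
  then have "1 / 4 \<le> (2 ^ Suc n - 2 ^ n) / width (2 ^ Suc n)"
    using width_pos[of "2 ^ Suc n"] by (simp add: field_simps)
  also have "\<dots> \<le> \<Lambda> (2 ^ Suc n) - \<Lambda> (2 ^ n)" by (intro \<Lambda>_diff_ge) auto
  finally show ?case using Suc by simp
qed simp

lemma \<Lambda>_surj:
  assumes "x \<ge> 0"
  obtains t where "t \<ge> 1" "\<Lambda> t = x"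
proof -
  obtain n where "real n > 4 * x" using reals_Archimedean2 by blast
  then have "x \<le> \<Lambda> (2 ^ n)" using \<Lambda>_unbounded[of n] by simp
  moreover have "continuous_on {1..2 ^ n} \<Lambda>"
    by (rule continuous_on_subset[OF continuous_on_\<Lambda>]) auto
  ultimately have "\<exists>t\<ge>1. t \<le> 2 ^ n \<and> \<Lambda> t = x"
    using assms by (intro IVT') simp_all
  then show ?thesis using that by blast
qed

lemma \<Lambda>_param_step:
  assumes "z \<in> \<Omega>"
  obtains d where "d > 0" "ball z d \<subseteq> \<Omega>"
    "\<And>z'. dist z z' < d \<Longrightarrow> \<bar>\<Lambda> (param z') - \<Lambda> (param z)\<bar> \<le> 4 / width (param z) * dist z z'"
proof -
  define S where "S = width (param z)"
  have "S > 0" using width_pos[of "param z"] param_ge_1[of z] by (simp add: S_def)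
  obtain r where r: "r > 0" "ball z r \<subseteq> \<Omega>" using openO assms by (auto elim: openE)
  \<comment> \<open>Within S/8 the parameter moves by at most S/4, so the width, being 2-Lipschitz,
    stays at least S/2. The slope is then at most 2/(S/2) = 4/S.\<close>
  define d where "d = min r (S / 8)"
  have "\<bar>\<Lambda> (param z') - \<Lambda> (param z)\<bar> \<le> 4 / S * dist z z'" if z': "dist z z' < d" for z'
  proof -
    have p: "\<bar>param z' - param z\<bar> \<le> 2 * dist z z'"
      using param_lipschitz[OF r(2)] z' by (simp add: d_def)
    define a where "a = min (param z') (param z)"
    define b where "b = max (param z') (param z)"
    have ab: "1 \<le> a" "a \<le> b" "b - a \<le> 2 * dist z z'"
      using p param_ge_1[of z] param_ge_1[of z'] by (auto simp: a_def b_def)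
    have "\<bar>param z - a\<bar> \<le> S / 4" using p z' unfolding a_def d_def by linarith
    moreover have "S - width a \<le> 2 * \<bar>param z - a\<bar>"
      using width_lipschitz[of "param z" a] by (simp add: S_def abs_le_iff)
    ultimately have wa: "S / 2 \<le> width a" by (simp add: field_simps)
    have "\<bar>\<Lambda> (param z') - \<Lambda> (param z)\<bar> = \<Lambda> b - \<Lambda> a"
      using \<Lambda>_mono[of "param z'" "param z"] \<Lambda>_mono[of "param z" "param z'"] param_ge_1[of z] param_ge_1[of z']
      by (auto simp: a_def b_def min_def max_def)
    also have "\<dots> \<le> (b - a) / width a" using ab by (intro \<Lambda>_diff_le)
    also have "\<dots> \<le> (2 * dist z z') / (S / 2)"
      using ab wa \<open>S > 0\<close> by (intro frac_le) auto
    finally show ?thesis using \<open>S > 0\<close> by (simp add: field_simps)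
  qed
  moreover have "d > 0" "ball z d \<subseteq> \<Omega>" using r \<open>S > 0\<close> by (auto simp: d_def)
  ultimately show ?thesis using that[of d] by (simp add: S_def)
qed

lemma continuous_on_\<Lambda>_param: "continuous_on \<Omega> (\<lambda>z. \<Lambda> (param z))"
proof -
  have "isCont (\<lambda>z. \<Lambda> (param z)) z" if "z \<in> \<Omega>" for z
  proof -
    obtain d where d: "d > 0" "\<And>z'. dist z z' < d \<Longrightarrow> \<bar>\<Lambda> (param z') - \<Lambda> (param z)\<bar> \<le> 4 / width (param z) * dist z z'"
      using \<Lambda>_param_step[OF \<open>z \<in> \<Omega>\<close>] by metis
    have "((\<lambda>z'. 4 / width (param z) * dist z z') \<longlongrightarrow> 4 / width (param z) * dist z z) (at z)"
      by (intro tendsto_intros)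
    then have "((\<lambda>z'. 4 / width (param z) * dist z z') \<longlongrightarrow> 0) (at z)" by simp
    moreover have "\<forall>\<^sub>F z' in at z. norm (\<Lambda> (param z') - \<Lambda> (param z)) \<le> 4 / width (param z) * dist z z'"
      using d unfolding eventually_at by (auto simp: dist_commute intro!: exI[of _ d])
    ultimately have "((\<lambda>z'. \<Lambda> (param z') - \<Lambda> (param z)) \<longlongrightarrow> 0) (at z)"
      by (rule Lim_null_comparison[rotated])
    then show ?thesis by (simp add: isCont_def LIM_zero_iff)
  qed
  then show ?thesis by (simp add: continuous_at_imp_continuous_on)
qed

end

section \<open>Hyperbolic length along the curve\<close>

locale upward_hyperbolic_domain = upward_domain + hyperbolic_domain
begin

section \<open>Lower bound for the hyperbolic length of paths\<close>

text \<open>The weak Koebe bound at a complement point within three widths of \<open>z\<close>; 576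
  = 4 * 3 * 48.\<close>

lemma density_ge_width:
  assumes "z \<in> \<Omega>"
  shows "4 / width (param z) \<le> 576 * pi * density z"
proof -
  have w: "width (param z) > 0" using width_pos[of "param z"] param_ge_1[of z] by simp
  obtain p where p: "p \<notin> \<Omega>" "dist z p \<le> 3 * width (param z)"
    using complement_within_width[OF assms] .
  have "dist z p > 0" using p(1) assms by auto
  then have "1 / (48 * pi * (3 * width (param z))) \<le> 1 / (48 * pi * norm (z - p))"
    using p(2) w by (intro divide_left_mono mult_left_mono) (auto simp: dist_norm)
  also have "\<dots> \<le> density z" using density_ge[OF assms p(1)] .
  finally show ?thesis using w by (simp add: field_simps)
qed

text \<open>At each point of differentiability the local Lipschitz constant of
  \<open>\<Lambda>\<close> after \<open>param\<close> is at most \<open>576 * pi\<close> times the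
  density, so increments along the path are controlled by hyperbolic speed. The gauge mean value
  inequality turns this into a bound by the length, without differentiating
  \<open>param\<close>.\<close>

lemma \<Lambda>_param_le_length:
  assumes "valid_path \<gamma>" "path_image \<gamma> \<subseteq> \<Omega>"
    and L: "((\<lambda>t. hyperbolic_metric \<Omega> (\<gamma> t) (vector_derivative \<gamma> (at t within {0..1}))) has_integral L) {0..1}"
  shows "\<Lambda> (param (pathfinish \<gamma>)) - \<Lambda> (param (pathstart \<gamma>)) \<le> 576 * pi * L"
proof -
  define H where "H t = \<Lambda> (param (\<gamma> t))" for t
  define v where "v t = vector_derivative \<gamma> (at t within {0..1})" for t
  define f where "f t = 576 * pi * (density (\<gamma> t) * norm (v t))" for t
  obtain X where X: "finite X" "\<gamma> C1_differentiable_on ({0..1} - X)" and cont: "continuous_on {0..1} \<gamma>"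
    using assms(1) by (auto simp: valid_path_def piecewise_C1_differentiable_on_def)
  have in\<Omega>: "\<gamma> t \<in> \<Omega>" if "t \<in> {0..1}" for t
    using assms(2) that by (auto simp: path_image_def)
  have f: "(f has_integral 576 * pi * L) {0..1}"
    unfolding f_def using has_integral_mult_right[OF L, of "576 * pi"]
    by (simp add: hyperbolic_metric_eq v_def)
  have "H 1 - H 0 \<le> integral {0..1} f"
  proof (rule straddle_le_integral_finite[OF X(1)])
    show "f integrable_on {0..1}" using f by blast
    show "continuous_on {0..1} H"
      unfolding H_def using in\<Omega> by (intro continuous_on_compose2[OF continuous_on_\<Lambda>_param cont]) auto
    fix x e :: real assume x: "x \<in> {0..1} - X" and "e > 0"
    define C where "C = 576 * pi * density (\<gamma> x)"
    have "C > 0" using density_pos in\<Omega> x by (simp add: C_def)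
    have fx: "f x = C * norm (v x)" by (simp add: f_def C_def)
    have "\<gamma> differentiable (at x within {0..1})"
      using X(2) x unfolding C1_differentiable_on_eq by (blast intro: differentiable_at_withinI)
    then have "(\<gamma> has_vector_derivative v x) (at x within {0..1})"
      unfolding v_def by (simp only: vector_derivative_works)
    then have der: "\<forall>e>0. \<exists>d>0. \<forall>y\<in>{0..1}. norm (y - x) < d \<longrightarrow>
        norm (\<gamma> y - \<gamma> x - (y - x) *\<^sub>R v x) \<le> e * norm (y - x)"
      unfolding has_vector_derivative_def has_derivative_within_alt by blast
    \<comment> \<open>The linearisation error of the path is multiplied by \<open>C\<close> below,
      which leaves \<open>e\<close>.\<close>
    have "e / C > 0" using \<open>e > 0\<close> \<open>C > 0\<close> by simp
    then obtain d1 where d1: "d1 > 0" "\<And>y. y \<in> {0..1} \<Longrightarrow> \<bar>y - x\<bar> < d1 \<Longrightarrow>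
        norm (\<gamma> y - \<gamma> x - (y - x) *\<^sub>R v x) \<le> e / C * \<bar>y - x\<bar>"
      using der by (metis real_norm_def)
    obtain d2 where d2: "d2 > 0" "\<And>z'. dist (\<gamma> x) z' < d2 \<Longrightarrow>
        \<bar>\<Lambda> (param z') - \<Lambda> (param (\<gamma> x))\<bar> \<le> 4 / width (param (\<gamma> x)) * dist (\<gamma> x) z'"
      using \<Lambda>_param_step[of "\<gamma> x"] in\<Omega> x by (metis DiffD1)
    obtain d3 where d3: "d3 > 0" "\<And>y. y \<in> {0..1} \<Longrightarrow> dist y x < d3 \<Longrightarrow> dist (\<gamma> y) (\<gamma> x) < d2"
      using cont x d2(1) unfolding continuous_on_iff by (metis DiffD1)
    have "\<bar>H y - H x\<bar> \<le> (f x + e) * \<bar>y - x\<bar>" if y: "y \<in> {0..1}" "\<bar>y - x\<bar> < min d1 d3" for y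
    proof -
      have "\<bar>H y - H x\<bar> \<le> 4 / width (param (\<gamma> x)) * dist (\<gamma> x) (\<gamma> y)"
        unfolding H_def using y d3(2)[of y] by (intro d2(2)) (simp add: dist_commute[of "\<gamma> x"] dist_real_def)
      also have "\<dots> \<le> C * norm (\<gamma> y - \<gamma> x)"
        unfolding C_def dist_norm norm_minus_commute[of "\<gamma> x"]
        using in\<Omega> x by (intro mult_right_mono density_ge_width) auto
      also have "norm (\<gamma> y - \<gamma> x) \<le> norm (\<gamma> y - \<gamma> x - (y - x) *\<^sub>R v x) + norm ((y - x) *\<^sub>R v x)"
        using norm_triangle_ineq[of "\<gamma> y - \<gamma> x - (y - x) *\<^sub>R v x" "(y - x) *\<^sub>R v x"] by simp
      also have "\<dots> \<le> e / C * \<bar>y - x\<bar> + \<bar>y - x\<bar> * norm (v x)"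
        using d1(2)[of y] y by simp
      also have "C * (e / C * \<bar>y - x\<bar> + \<bar>y - x\<bar> * norm (v x)) = (f x + e) * \<bar>y - x\<bar>"
        using \<open>C > 0\<close> by (simp add: fx algebra_simps)
      finally show ?thesis using \<open>C > 0\<close> by simp
    qed
    then show "\<exists>d>0. \<forall>y\<in>{0..1}. \<bar>y - x\<bar> < d \<longrightarrow> \<bar>H y - H x\<bar> \<le> (f x + e) * \<bar>y - x\<bar>"
      using d1(1) d3(1) by (intro exI[of _ "min d1 d3"]) simp
  qed simp
  also have "\<dots> = 576 * pi * L" using f by (rule integral_unique)
  finally show ?thesis by (simp add: H_def pathfinish_def pathstart_def)
qed

section \<open>Hyperbolic distance along the curve, and its reparametrization\<close>

definition curve :: "real \<Rightarrow> complex" where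
  "curve t = Complex (shift t) t"

lemma curve_in: "t \<ge> 1 \<Longrightarrow> curve t \<in> \<Omega>"
  using ball_shift_subset[of t] width_pos[of t] by (auto simp: curve_def)

lemma continuous_on_curve: "continuous_on X curve"
proof -
  have "continuous_on UNIV shift"
    using shift_lipschitz by (intro lipschitz_on_continuous_on[of 1] lipschitz_onI) (auto simp: dist_real_def)
  then have "continuous_on X shift" by (rule continuous_on_subset) simp
  then show ?thesis
    unfolding curve_def Complex_eq by (intro continuous_intros)
qed

text \<open>The curve is only known to be Lipschitz, so its real part is replaced by a C1 function.
  The new path keeps distance \<open>width / 5\<close> from the complement and has speed at most 3
  per unit of height, whence 15 = 5 * 3.\<close>

lemma short_path:
  assumes "1 \<le> s" "s \<le> t"
  obtains \<gamma> L where "valid_path \<gamma>" "path_image \<gamma> \<subseteq> \<Omega>" "pathstart \<gamma> = curve s" "pathfinish \<gamma> = curve t"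
    "((\<lambda>t. hyperbolic_metric \<Omega> (\<gamma> t) (vector_derivative \<gamma> (at t within {0..1}))) has_integral L) {0..1}"
    "L \<le> 15 * (\<Lambda> t - \<Lambda> s)"
proof (cases "s = t")
  case True
  define \<gamma> where "\<gamma> = linepath (curve s) (curve s)"
  have "((\<lambda>t. hyperbolic_metric \<Omega> (\<gamma> t) (vector_derivative \<gamma> (at t within {0..1}))) has_integral 0) {0..1}"
    by (rule has_integral_is_0) (simp add: \<gamma>_def hyperbolic_metric_eq vector_derivative_linepath_within)
  moreover have "path_image \<gamma> \<subseteq> \<Omega>" using curve_in[of s] assms by (simp add: \<gamma>_def)
  ultimately show ?thesis using that[of \<gamma> 0] True by (simp add: \<gamma>_def)
next
  case False
  then have "s < t" using assms by simp
  have ws: "width s > 0" using width_pos[of s] assms by simp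
  \<comment> \<open>As the width is nondecreasing, a tenth of its value at \<open>s\<close> is a
    tolerance for the whole interval; 1/3 - 1/10 exceeds 1/5.\<close>
  obtain q q' where q: "q s = shift s" "q t = shift t"
    "\<And>u. u \<in> {s..t} \<Longrightarrow> (q has_real_derivative q' u) (at u)"
    "continuous_on {s..t} q'"
    "\<And>u. u \<in> {s..t} \<Longrightarrow> \<bar>q' u\<bar> \<le> 2"
    "\<And>u. u \<in> {s..t} \<Longrightarrow> \<bar>q u - shift u\<bar> \<le> width s / 10"
    using lipschitz_C1_approximation[OF shift_lipschitz \<open>s < t\<close>, of "width s / 10"] ws
    by (metis divide_pos_pos zero_less_numeral)
  define a where "a \<tau> = s + \<tau> * (t - s)" for \<tau>
  have a: "a \<tau> \<in> {s..t}" if "\<tau> \<in> {0..1}" for \<tau>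
  proof -
    have "a \<tau> \<le> s + 1 * (t - s)"
      unfolding a_def using that \<open>s < t\<close> by (intro add_left_mono mult_right_mono) auto
    moreover have "s \<le> a \<tau>" using that \<open>s < t\<close> by (simp add: a_def)
    ultimately show ?thesis by simp
  qed
  define \<gamma> where "\<gamma> \<tau> = of_real (q (a \<tau>)) + \<i> * of_real (a \<tau>)" for \<tau>
  define v where "v \<tau> = of_real (q' (a \<tau>) * (t - s)) + \<i> * of_real (t - s)" for \<tau>
  have der_a: "(a has_real_derivative (t - s)) (at \<tau>)" for \<tau>
    unfolding a_def by (auto intro!: derivative_eq_intros)
  have cont_a: "continuous_on {0..1} a" unfolding a_def by (intro continuous_intros)
  have der: "(\<gamma> has_vector_derivative v \<tau>) (at \<tau>)" if "\<tau> \<in> {0..1}" for \<tau>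
    unfolding \<gamma>_def v_def
    by (intro has_vector_derivative_add has_vector_derivative_mult_right has_vector_derivative_of_real
        der_a DERIV_chain2[of q] q(3) a that)
  have cont_v: "continuous_on {0..1} v"
    unfolding v_def using a by (intro continuous_intros continuous_on_compose2[OF q(4) cont_a]) auto
  have "\<gamma> C1_differentiable_on {0..1}"
    unfolding C1_differentiable_on_def using der cont_v by blast
  then have valid: "valid_path \<gamma>"
    unfolding valid_path_def by (rule C1_differentiable_imp_piecewise)
  have cont\<gamma>: "continuous_on {0..1} \<gamma>"
    using valid by (simp add: valid_path_imp_path path_def[symmetric])
  have ball: "ball (\<gamma> \<tau>) (width (a \<tau>) / 5) \<subseteq> \<Omega>" if "\<tau> \<in> {0..1}" for \<tau>
  proof -
    have "\<gamma> \<tau> - curve (a \<tau>) = of_real (q (a \<tau>) - shift (a \<tau>))"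
      by (simp add: \<gamma>_def curve_def complex_eq_iff)
    then have "dist (curve (a \<tau>)) (\<gamma> \<tau>) = \<bar>q (a \<tau>) - shift (a \<tau>)\<bar>"
      unfolding dist_norm norm_minus_commute[of "curve (a \<tau>)"] by (simp only: norm_of_real)
    also have "\<dots> \<le> width s / 10" by (rule q(6)[OF a[OF that]])
    also have "\<dots> \<le> width (a \<tau>) / 10" using width_mono[of s "a \<tau>"] a[OF that] by simp
    finally have "dist (curve (a \<tau>)) (\<gamma> \<tau>) + width (a \<tau>) / 5 \<le> width (a \<tau>) / 3"
      using width_pos[of "a \<tau>"] a[OF that] assms by simp
    then have "ball (\<gamma> \<tau>) (width (a \<tau>) / 5) \<subseteq> ball (curve (a \<tau>)) (width (a \<tau>) / 3)"
      by (subst ball_subset_ball_iff) (simp add: dist_commute)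
    then show ?thesis using ball_shift_subset[of "a \<tau>"] by (simp add: curve_def)
  qed
  have wa: "width (a \<tau>) > 0" if "\<tau> \<in> {0..1}" for \<tau>
    using width_pos[of "a \<tau>"] a[OF that] assms by simp
  have in\<Omega>: "\<gamma> \<tau> \<in> \<Omega>" if "\<tau> \<in> {0..1}" for \<tau>
    using ball[OF that] wa[OF that] by (meson centre_in_ball divide_pos_pos subsetD zero_less_numeral)
  define f where "f \<tau> = density (\<gamma> \<tau>) * norm (v \<tau>)" for \<tau>
  have vd: "vector_derivative \<gamma> (at \<tau> within {0..1}) = v \<tau>" if "\<tau> \<in> {0..1}" for \<tau>
    using vector_derivative_at_within_ivl[OF der[OF that], of 0 1] that by simp
  have "continuous_on {0..1} f"
    unfolding f_def using in\<Omega>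
    by (intro continuous_intros cont_v continuous_on_compose2[OF continuous_on_density cont\<gamma>]) auto
  then have int: "(f has_integral integral {0..1} f) {0..1}"
    by (intro integrable_integral integrable_continuous_real)
  \<comment> \<open>The majorant of the hyperbolic speed is integrated exactly, with
    \<open>15 * \<Lambda> (a \<tau>)\<close> as antiderivative.\<close>
  have "((\<lambda>\<tau>. 15 * (1 / width (a \<tau>) * (t - s))) has_integral 15 * \<Lambda> (a 1) - 15 * \<Lambda> (a 0)) {0..1}"
  proof (rule fundamental_theorem_of_calculus)
    fix \<tau> :: real assume \<tau>: "\<tau> \<in> {0..1}"
    have "(\<Lambda> has_real_derivative 1 / width (a \<tau>)) (at (a \<tau>) within a ` {0..1})"
      using a[OF \<tau>] a assms by (intro has_field_derivative_subset[OF \<Lambda>_has_derivative[of "a \<tau>" t]]) force+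
    then have "(\<Lambda> \<circ> a has_real_derivative 1 / width (a \<tau>) * (t - s)) (at \<tau> within {0..1})"
      by (rule DERIV_image_chain) (rule has_field_derivative_at_within[OF der_a])
    then have "((\<lambda>\<tau>. 15 * \<Lambda> (a \<tau>)) has_real_derivative 15 * (1 / width (a \<tau>) * (t - s))) (at \<tau> within {0..1})"
      unfolding o_def by (rule DERIV_cmult)
    then show "((\<lambda>\<tau>. 15 * \<Lambda> (a \<tau>)) has_vector_derivative 15 * (1 / width (a \<tau>) * (t - s))) (at \<tau> within {0..1})"
      by (simp only: has_real_derivative_iff_has_vector_derivative)
  qed simp
  moreover have "f \<tau> \<le> 15 * (1 / width (a \<tau>) * (t - s))" if "\<tau> \<in> {0..1}" for \<tau>
  proof -
    have "density (\<gamma> \<tau>) \<le> 5 / width (a \<tau>)"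
      using density_le[OF ball[OF that]] wa[OF that] by simp
    moreover have "norm (v \<tau>) \<le> 3 * (t - s)"
    proof -
      have "norm (v \<tau>) \<le> \<bar>q' (a \<tau>) * (t - s)\<bar> + \<bar>t - s\<bar>"
        using cmod_le[of "v \<tau>"] by (simp add: v_def)
      also have "\<dots> = \<bar>q' (a \<tau>)\<bar> * (t - s) + (t - s)" using \<open>s < t\<close> by (simp add: abs_mult)
      also have "\<dots> \<le> 2 * (t - s) + (t - s)"
        using q(5)[OF a[OF that]] \<open>s < t\<close> by (intro add_mono mult_right_mono) auto
      finally show ?thesis by simp
    qed
    ultimately have "f \<tau> \<le> 5 / width (a \<tau>) * (3 * (t - s))"
      unfolding f_def using wa[OF that] by (intro mult_mono) auto
    then show ?thesis by simp
  qed
  ultimately have "integral {0..1} f \<le> 15 * \<Lambda> (a 1) - 15 * \<Lambda> (a 0)"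
    by (intro has_integral_le[OF int]) auto
  then have "integral {0..1} f \<le> 15 * (\<Lambda> t - \<Lambda> s)" by (simp add: a_def)
  moreover have "((\<lambda>t. hyperbolic_metric \<Omega> (\<gamma> t) (vector_derivative \<gamma> (at t within {0..1})))
      has_integral integral {0..1} f) {0..1}"
    using int by (rule has_integral_eq[rotated]) (simp add: hyperbolic_metric_eq f_def vd)
  moreover have "path_image \<gamma> \<subseteq> \<Omega>" using in\<Omega> by (auto simp: path_image_def)
  moreover have "pathstart \<gamma> = curve s" "pathfinish \<gamma> = curve t"
    using q(1,2) by (simp_all add: pathstart_def pathfinish_def \<gamma>_def a_def curve_def Complex_eq)
  ultimately show ?thesis using that[OF valid] by blast
qed

lemma hyperbolic_distance_curve:
  assumes "1 \<le> s" "s \<le> t"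
  shows "hyperbolic_distance \<Omega> (curve s) (curve t) \<le> 15 * (\<Lambda> t - \<Lambda> s)"
    and "(\<Lambda> t - \<Lambda> s) / (576 * pi) - 1 \<le> hyperbolic_distance \<Omega> (curve s) (curve t)"
proof -
  define K where "K = {L. \<exists>\<gamma>. valid_path \<gamma> \<and> path_image \<gamma> \<subseteq> \<Omega> \<and> pathstart \<gamma> = curve s \<and> pathfinish \<gamma> = curve t \<and>
            ((\<lambda>t. hyperbolic_metric \<Omega> (\<gamma> t) (vector_derivative \<gamma> (at t within {0..1})))
               has_integral L) {0..1}}"
  have dist: "hyperbolic_distance \<Omega> (curve s) (curve t) = Inf K"
    by (simp add: hyperbolic_distance_def K_def)
  have "\<exists>L\<in>K. L \<le> 15 * (\<Lambda> t - \<Lambda> s)"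
    by (rule short_path[OF assms]) (unfold K_def, blast)
  then obtain L where L: "L \<in> K" "L \<le> 15 * (\<Lambda> t - \<Lambda> s)" ..
  have lower: "(\<Lambda> t - \<Lambda> s) / (576 * pi) - 1 \<le> L" if LK: "L \<in> K" for L
  proof -
    obtain \<gamma> where \<gamma>: "valid_path \<gamma>" "path_image \<gamma> \<subseteq> \<Omega>" "pathstart \<gamma> = curve s" "pathfinish \<gamma> = curve t"
      "((\<lambda>t. hyperbolic_metric \<Omega> (\<gamma> t) (vector_derivative \<gamma> (at t within {0..1}))) has_integral L) {0..1}"
      using LK unfolding K_def mem_Collect_eq by metis
    have "\<Lambda> (param (curve t)) - \<Lambda> (param (curve s)) \<le> 576 * pi * L"
      using \<Lambda>_param_le_length[OF \<gamma>(1,2,5)] \<gamma>(3,4) by simp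
    moreover have "\<Lambda> t \<le> \<Lambda> (param (curve t))"
      using param_shift[of t] assms by (intro \<Lambda>_mono) (auto simp: curve_def)
    \<comment> \<open>\<open>param\<close> overshoots \<open>s\<close> by at most half the width
      there, which costs at most 1/2 in \<open>\<Lambda>\<close>. This is the source of the additive
      constant.\<close>
    moreover have "\<Lambda> (param (curve s)) \<le> \<Lambda> s + 1 / 2"
    proof -
      have "\<Lambda> (param (curve s)) - \<Lambda> s \<le> (param (curve s) - s) / width s"
        using param_shift[of s] assms by (intro \<Lambda>_diff_le) (auto simp: curve_def)
      also have "\<dots> \<le> (width s / 2) / width s"
        using param_shift[of s] assms width_pos[of s] by (intro divide_right_mono) (auto simp: curve_def)
      also have "\<dots> = 1 / 2" using assms width_pos[of s] by simp
      finally show ?thesis by simp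
    qed
    ultimately have "\<Lambda> t - \<Lambda> s \<le> 576 * pi * L + 1 / 2" by linarith
    also have "\<dots> \<le> 576 * pi * (L + 1)" using pi_gt3 by (simp add: distrib_left)
    finally show ?thesis by (simp add: field_simps)
  qed
  show "hyperbolic_distance \<Omega> (curve s) (curve t) \<le> 15 * (\<Lambda> t - \<Lambda> s)"
    unfolding dist using cInf_lower[OF L(1) bdd_belowI[OF lower]] L(2) by linarith
  show "(\<Lambda> t - \<Lambda> s) / (576 * pi) - 1 \<le> hyperbolic_distance \<Omega> (curve s) (curve t)"
    unfolding dist using L(1) lower by (intro cInf_greatest) auto
qed

text \<open>\<open>\<Lambda>\<^sup>-\<^sup>1\<close>, extended to the negative reals so as to be an increasing surjection of the
  line, which makes its continuity immediate.\<close>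

definition \<Psi> :: "real \<Rightarrow> real" where
  "\<Psi> x = (if x < 0 then x + 1 else SOME t. t \<ge> 1 \<and> \<Lambda> t = x)"

lemma \<Psi>:
  assumes "x \<ge> 0"
  shows "\<Psi> x \<ge> 1" "\<Lambda> (\<Psi> x) = x"
proof -
  obtain t where "t \<ge> 1" "\<Lambda> t = x" using \<Lambda>_surj[OF assms] .
  then have "\<exists>t. t \<ge> 1 \<and> \<Lambda> t = x" by blast
  then have "\<Psi> x \<ge> 1 \<and> \<Lambda> (\<Psi> x) = x"
    using assms someI_ex[of "\<lambda>t. t \<ge> 1 \<and> \<Lambda> t = x"] by (simp add: \<Psi>_def)
  then show "\<Psi> x \<ge> 1" "\<Lambda> (\<Psi> x) = x" by simp_all
qed

lemma \<Lambda>_nonneg: "t \<ge> 1 \<Longrightarrow> \<Lambda> t \<ge> 0"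
  using \<Lambda>_mono[of 1 t] by simp

lemma \<Psi>_\<Lambda>: "t \<ge> 1 \<Longrightarrow> \<Psi> (\<Lambda> t) = t"
  using \<Psi>[of "\<Lambda> t"] \<Lambda>_nonneg[of t] \<Lambda>_strict_mono[of t "\<Psi> (\<Lambda> t)"] \<Lambda>_strict_mono[of "\<Psi> (\<Lambda> t)" t]
  by linarith

lemma strict_mono_\<Psi>: "strict_mono \<Psi>"
proof (rule strict_monoI)
  fix x y :: real assume "x < y"
  show "\<Psi> x < \<Psi> y"
  proof (cases "x < 0")
    case True
    then show ?thesis using \<Psi>(1)[of y] \<open>x < y\<close> by (cases "y < 0") (auto simp: \<Psi>_def[of x] \<Psi>_def[of y])
  next
    case False
    then show ?thesis
      using \<Psi>[of x] \<Psi>[of y] \<open>x < y\<close> \<Lambda>_mono[of "\<Psi> y" "\<Psi> x"] by (smt (verit))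
  qed
qed

lemma surj_\<Psi>: "surj \<Psi>"
proof -
  have "\<exists>x. y = \<Psi> x" for y
  proof (cases "y < 1")
    case True
    then have "y = \<Psi> (y - 1)" by (simp add: \<Psi>_def)
    then show ?thesis by blast
  next
    case False
    then have "y = \<Psi> (\<Lambda> y)" by (simp add: \<Psi>_\<Lambda>)
    then show ?thesis by blast
  qed
  then show ?thesis by (simp add: surj_def)
qed

lemma continuous_on_\<Psi>: "continuous_on X \<Psi>"
proof -
  have "continuous_on UNIV \<Psi>"
    using strict_mono_\<Psi> surj_\<Psi> by (intro continuous_onI_mono) (auto simp: strict_mono_less_eq)
  then show ?thesis by (rule continuous_on_subset) simp
qed

lemma homeomorphism_\<Psi>: "homeomorphism {0..} {1..} \<Psi> \<Lambda>"
proof (rule homeomorphismI)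
  show "continuous_on {0..} \<Psi>" by (rule continuous_on_\<Psi>)
  show "continuous_on {1..} \<Lambda>" by (rule continuous_on_\<Lambda>)
qed (use \<Psi> \<Psi>_\<Lambda> \<Lambda>_nonneg in auto)

text \<open>In the parameter \<open>\<Lambda>\<close> both distance estimates become linear; the
  constants are A = 576 * pi, which also dominates 15, and B = 1.\<close>

lemma reparametrizable_curve: "reparametrizable_quasi_geodesic \<Omega> 1 \<infinity> curve"
proof -
  have ico: "ico c \<infinity> = {c..}" for c by (auto simp: ico_def)
  have "quasi_geodesic \<Omega> 0 \<infinity> (curve \<circ> \<Psi>)"
    unfolding quasi_geodesic_def ico
  proof (intro conjI exI ballI impI)
    show "continuous_on {0..} (curve \<circ> \<Psi>)"
      by (intro continuous_on_compose continuous_on_\<Psi> continuous_on_curve)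
    show "(curve \<circ> \<Psi>) ` {0..} \<subseteq> \<Omega>" using \<Psi>(1) curve_in by auto
    show "(576 * pi :: real) \<ge> 1" "(1::real) \<ge> 0" using pi_gt3 by simp_all
    fix s t :: real assume st: "s \<in> {0..}" "t \<in> {0..}" "s \<le> t"
    then have ps: "1 \<le> \<Psi> s" "\<Psi> s \<le> \<Psi> t" "\<Lambda> (\<Psi> s) = s" "\<Lambda> (\<Psi> t) = t"
      using \<Psi>[of s] \<Psi>[of t] strict_mono_\<Psi> by (auto simp: strict_mono_less_eq)
    show "1 / (576 * pi) * (t - s) - 1 \<le> hyperbolic_distance \<Omega> ((curve \<circ> \<Psi>) s) ((curve \<circ> \<Psi>) t)"
      using hyperbolic_distance_curve(2)[OF ps(1,2)] ps(3,4) by simp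
    have "hyperbolic_distance \<Omega> ((curve \<circ> \<Psi>) s) ((curve \<circ> \<Psi>) t) \<le> 15 * (t - s)"
      using hyperbolic_distance_curve(1)[OF ps(1,2)] ps(3,4) by simp
    also have "\<dots> \<le> 576 * pi * (t - s)" using st pi_gt3 by (intro mult_right_mono) auto
    finally show "hyperbolic_distance \<Omega> ((curve \<circ> \<Psi>) s) ((curve \<circ> \<Psi>) t) \<le> 576 * pi * (t - s) + 1"
      by simp
  qed simp
  moreover have "strict_mono_on {0..} \<Psi>"
    using strict_mono_\<Psi> by (simp add: strict_mono_on_def strict_mono_def)
  ultimately show ?thesis
    unfolding reparametrizable_quasi_geodesic_def
    using homeomorphism_\<Psi> by (intro exI[of _ 0] exI[of _ \<infinity>] exI[of _ \<Psi>] exI[of _ \<Lambda>]) (simp add: ico)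
qed

end

text \<open>The theorem prescribes \<sigma> on the half-line from 1 only, so \<sigma> and
  \<open>curve\<close> may differ elsewhere.\<close>

lemma quasi_geodesic_cong:
  assumes "\<And>t. t \<in> ico a b \<Longrightarrow> f t = g t"
  shows "quasi_geodesic \<Omega> a b f \<longleftrightarrow> quasi_geodesic \<Omega> a b g"
proof -
  have "continuous_on (ico a b) f \<longleftrightarrow> continuous_on (ico a b) g" "f ` ico a b = g ` ico a b"
    using assms by (auto cong: continuous_on_cong)
  then show ?thesis using assms unfolding quasi_geodesic_def by (simp cong: ball_cong)
qed

theorem theorem4p2:
  fixes \<Omega> :: "complex set" and \<sigma> :: "real \<Rightarrow> complex"
  assumes "starlike_at_infinity \<Omega>"
    and "0 \<notin> \<Omega>"
    and "\<And>t::real. t > 0 \<Longrightarrow> \<i> * of_real t \<in> \<Omega>"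
    and "\<And>t. t \<ge> 1 \<Longrightarrow> \<sigma> t = of_real ((delta_plus \<Omega> t - delta_minus \<Omega> t) / 2) + \<i> * of_real t"
  shows "\<sigma> ` {1..} \<subseteq> \<Omega> \<and> continuous_on {1..} \<sigma> \<and>
         reparametrizable_quasi_geodesic \<Omega> 1 \<infinity> \<sigma>"
proof -
  interpret upward_hyperbolic_domain \<Omega>
  proof
    show "open \<Omega>" "connected \<Omega>" "simply_connected \<Omega>" "\<Omega> \<noteq> {}" "\<Omega> \<noteq> UNIV"
      using assms(1) by (simp_all add: starlike_at_infinity_def)
    show "z + \<i> * of_real t \<in> \<Omega>" if "z \<in> \<Omega>" "t \<ge> 0" for z t
      using assms(1) that unfolding starlike_at_infinity_def by blast
    show "Complex 0 t \<in> \<Omega>" if "t > 0" for t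
      using assms(3)[OF that] by (simp add: Complex_eq)
  qed (rule assms(2))
  have \<sigma>: "\<sigma> t = curve t" if "t \<ge> 1" for t
    using assms(4)[OF that] that by (simp add: delta_plus_eq delta_minus_eq curve_def shift_def Complex_eq)
  obtain a' b' \<psi> \<phi> where rep: "ereal a' < b'" "homeomorphism (ico a' b') (ico 1 \<infinity>) \<psi> \<phi>"
    "strict_mono_on (ico a' b') \<psi>" "quasi_geodesic \<Omega> a' b' (curve \<circ> \<psi>)"
    using reparametrizable_curve unfolding reparametrizable_quasi_geodesic_def by blast
  have "\<psi> t \<ge> 1" if "t \<in> ico a' b'" for t
    using homeomorphism_image1[OF rep(2)] that by (auto simp: ico_def)
  then have "quasi_geodesic \<Omega> a' b' (\<sigma> \<circ> \<psi>)"
    using rep(4) \<sigma> by (subst quasi_geodesic_cong[where g = "curve \<circ> \<psi>"]) auto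
  then have "reparametrizable_quasi_geodesic \<Omega> 1 \<infinity> \<sigma>"
    unfolding reparametrizable_quasi_geodesic_def using rep(1-3) by blast
  moreover have "continuous_on {1..} \<sigma>"
    by (rule continuous_on_eq[OF continuous_on_curve]) (simp add: \<sigma>)
  moreover have "\<sigma> ` {1..} \<subseteq> \<Omega>" using \<sigma> curve_in by auto
  ultimately show ?thesis by blast
qed

end
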